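(* ($p$-adic multilinear estimate.) Let $k\in\mathbb Z_+$ with $k\ge2$, and let $\mathcal P=(P_1,\dots,P_k)$, where $P_1,\dots,P_k$ are polynomials with integer coefficients and degrees $d_i=\deg P_i$ satisfying $1\le d_1<\cdots<d_k$. Set $D_k=10kd_k$. Let $1\le q\le\infty$ and $D_k\le q_1,\dots,q_k<\infty$. Then $$\|A_{\mathbb Z_p}\|_{L^{q_1}(\mathbb Z_p)\times\cdots\times L^{q_k}(\mathbb Z_p)\to L^q(\mathbb Z_p)}\lesssim_{\mathcal P}1,$$ where the implicit constant is independent of the prime $p$.
   Context: For a prime $p$, $\mathbb Z_p$ is the ring of $p$-adic integers with Haar probability measure $\nu_{\mathbb Z_p}$, and $$A_{\mathbb Z_p}(f_1,\dots,f_k)(x)=\int_{\mathbb Z_p}f_1(x-P_1(y))\cdots f_k(x-P_k(y))\,d\nu_{\mathbb Z_p}(y),\qquad x\in\mathbb Z_p.$$ The operator norm is the least $C$ with $\|A_{\mathbb Z_p}(f_1,\dots,f_k)\|_{L^q(\mathbb Z_p)}\le C\prod_i\|f_i\|_{L^{q_i}(\mathbb Z_p)}$ for all $f_i\in L^{q_i}(\mathbb Z_p)$. The implied constant may also depend on the exponents. *)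

theory Defs
  imports
    "HOL-Probability.Probability"
    "HOL-Algebra.Ring"
    "HOL-Computational_Algebra.Polynomial"
    "HOL-Computational_Algebra.Primes"
begin

text \<open>The p-adic integers are the inverse limit of the rings of integers modulo \<open>p ^ n\<close>: an
  element is a coherent sequence of residues, \<open>x n\<close> being the residue modulo \<open>p ^ n\<close>. The prime
  is a term and not a type, so that a bound can be stated uniformly in it.\<close>

definition Zp :: "nat \<Rightarrow> (nat \<Rightarrow> int) ring" where
  "Zp p =
    \<lparr>carrier = {x. \<forall>n. x n \<in> {0..<int p ^ n} \<and> x (Suc n) mod int p ^ n = x n},
     mult = (\<lambda>x y n. (x n * y n) mod int p ^ n),
     one = (\<lambda>n. 1 mod int p ^ n),
     zero = (\<lambda>n. 0),
     add = (\<lambda>x y n. (x n + y n) mod int p ^ n)\<rparr>"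

definition Zp_poly :: "nat \<Rightarrow> int poly \<Rightarrow> (nat \<Rightarrow> int) \<Rightarrow> (nat \<Rightarrow> int)" where
  "Zp_poly p P y =
    finsum (Zp p) (\<lambda>i. [coeff P i] \<cdot>\<^bsub>Zp p\<^esub> (y [^]\<^bsub>Zp p\<^esub> i)) {..degree P}"

lemma Zp_carrier_iff:
  "x \<in> carrier (Zp p) \<longleftrightarrow> (\<forall>n. 0 \<le> x n \<and> x n < int p ^ n \<and> x (Suc n) mod int p ^ n = x n)"
  by (auto simp: Zp_def)

lemma Zp_carrier_mod: "x \<in> carrier (Zp p) \<Longrightarrow> x n mod int p ^ n = x n"
  by (simp add: Zp_carrier_iff)

lemma Zp_carrierI:
  assumes "p > 0" "\<And>n. x n = f n mod int p ^ n" "\<And>n. f (Suc n) mod int p ^ n = f n mod int p ^ n"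
  shows "x \<in> carrier (Zp p)"
  using assms by (auto simp: Zp_carrier_iff mod_mod_cancel)

lemma Zp_mod_Suc: "x \<in> carrier (Zp p) \<Longrightarrow> x (Suc n) mod int p ^ n = x n"
  by (simp add: Zp_carrier_iff)

lemma Zp_simps [simp]:
  "mult (Zp p) x y = (\<lambda>n. (x n * y n) mod int p ^ n)"
  "one (Zp p) = (\<lambda>n. 1 mod int p ^ n)"
  "zero (Zp p) = (\<lambda>n. 0)"
  "add (Zp p) x y = (\<lambda>n. (x n + y n) mod int p ^ n)"
  by (simp_all add: Zp_def)

lemma Zp_closed:
  assumes "p > 0" "x \<in> carrier (Zp p)" "y \<in> carrier (Zp p)"
  shows "(\<lambda>n. (x n * y n) mod int p ^ n) \<in> carrier (Zp p)"
    "(\<lambda>n. (x n + y n) mod int p ^ n) \<in> carrier (Zp p)"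
    "(\<lambda>n. (x n - y n) mod int p ^ n) \<in> carrier (Zp p)"
    "(\<lambda>n. (- x n) mod int p ^ n) \<in> carrier (Zp p)"
    "(\<lambda>n. c mod int p ^ n) \<in> carrier (Zp p)"
proof -
  note m = Zp_mod_Suc[OF assms(2)] Zp_mod_Suc[OF assms(3)]
  show "(\<lambda>n. (x n * y n) mod int p ^ n) \<in> carrier (Zp p)"
    by (rule Zp_carrierI[OF assms(1) refl]) (metis m mod_mult_eq)
  show "(\<lambda>n. (x n + y n) mod int p ^ n) \<in> carrier (Zp p)"
    by (rule Zp_carrierI[OF assms(1) refl]) (metis m mod_add_eq)
  show "(\<lambda>n. (x n - y n) mod int p ^ n) \<in> carrier (Zp p)"
    by (rule Zp_carrierI[OF assms(1) refl]) (metis m mod_diff_eq)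
  show "(\<lambda>n. (- x n) mod int p ^ n) \<in> carrier (Zp p)"
    by (rule Zp_carrierI[OF assms(1) refl]) (metis m mod_minus_eq)
  show "(\<lambda>n. c mod int p ^ n) \<in> carrier (Zp p)"
    by (rule Zp_carrierI[OF assms(1) refl]) simp
qed

lemma Zp_cring:
  assumes p: "p > 0"
  shows "cring (Zp p)"
proof (rule cringI)
  have Z: "(\<lambda>n. 0) \<in> carrier (Zp p)"
    using p by (simp add: Zp_carrier_iff)
  show "abelian_group (Zp p)"
  proof (rule abelian_groupI)
    fix x assume x: "x \<in> carrier (Zp p)"
    show "\<exists>y\<in>carrier (Zp p). y \<oplus>\<^bsub>Zp p\<^esub> x = \<zero>\<^bsub>Zp p\<^esub>"
      by (rule bexI[OF _ Zp_closed(4)[OF p x x]]) (simp add: mod_simps)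
  next
    fix x assume x: "x \<in> carrier (Zp p)"
    show "\<zero>\<^bsub>Zp p\<^esub> \<oplus>\<^bsub>Zp p\<^esub> x = x"
      by (simp add: Zp_carrier_mod[OF x])
  qed (use p Z in \<open>auto simp: Zp_closed mod_simps algebra_simps\<close>)
  show "comm_monoid (Zp p)"
  proof (rule comm_monoidI)
    show "\<one>\<^bsub>Zp p\<^esub> \<in> carrier (Zp p)"
      using Zp_closed(5)[OF p Z Z, of 1] by simp
  next
    fix x assume x: "x \<in> carrier (Zp p)"
    show "\<one>\<^bsub>Zp p\<^esub> \<otimes>\<^bsub>Zp p\<^esub> x = x"
      by (simp add: mod_simps Zp_carrier_mod[OF x])
  qed (use p in \<open>auto simp: Zp_closed mod_simps algebra_simps\<close>)
qed (auto simp: mod_simps algebra_simps)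

lemma Zp_minus:
  assumes p: "p > 0" and x: "x \<in> carrier (Zp p)" and y: "y \<in> carrier (Zp p)"
  shows "x \<ominus>\<^bsub>Zp p\<^esub> y = (\<lambda>n. (x n - y n) mod int p ^ n)"
proof -
  interpret cring "Zp p" by (rule Zp_cring[OF p])
  have "\<ominus>\<^bsub>Zp p\<^esub> y = (\<lambda>n. (- y n) mod int p ^ n)"
    by (rule minus_equality) (use p y Zp_closed(4)[OF p y y] in \<open>auto simp: mod_simps\<close>)
  then show ?thesis
    by (simp add: a_minus_def mod_simps)
qed

lemma Zp_power:
  assumes p: "p > 0" and y: "y \<in> carrier (Zp p)"
  shows "y [^]\<^bsub>Zp p\<^esub> (i::nat) = (\<lambda>n. (y n ^ i) mod int p ^ n)"
proof -
  interpret cring "Zp p" by (rule Zp_cring[OF p])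
  show ?thesis
    by (induction i) (auto simp: mod_simps mult.commute)
qed

lemma Zp_add_pow:
  assumes p: "p > 0" and y: "y \<in> carrier (Zp p)"
  shows "[(c::int)] \<cdot>\<^bsub>Zp p\<^esub> y = (\<lambda>n. (c * y n) mod int p ^ n)"
proof -
  interpret cring "Zp p" by (rule Zp_cring[OF p])
  have nat: "[(m::nat)] \<cdot>\<^bsub>Zp p\<^esub> y = (\<lambda>n. (int m * y n) mod int p ^ n)" for m
    by (induction m) (use y in \<open>auto simp: mod_simps algebra_simps add.nat_pow_Suc\<close>)
  show ?thesis
  proof (cases "c \<ge> 0")
    case True
    then show ?thesis
      using nat[of "nat c"] by (simp add: add_pow_def int_pow_def nat_pow_def)
  next
    case False
    have "[c] \<cdot>\<^bsub>Zp p\<^esub> y = \<ominus>\<^bsub>Zp p\<^esub> ([nat (- c)] \<cdot>\<^bsub>Zp p\<^esub> y)"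
      using False by (simp add: add_pow_def int_pow_def nat_pow_def a_inv_def)
    also have "\<dots> = \<zero>\<^bsub>Zp p\<^esub> \<ominus>\<^bsub>Zp p\<^esub> ([nat (- c)] \<cdot>\<^bsub>Zp p\<^esub> y)"
      using y by (simp add: a_minus_def del: Zp_simps)
    also have "\<dots> = (\<lambda>n. (c * y n) mod int p ^ n)"
    proof (subst Zp_minus[OF p])
      show "[nat (- c)] \<cdot>\<^bsub>Zp p\<^esub> y \<in> carrier (Zp p)"
        using y by (rule add.nat_pow_closed)
      show "\<zero>\<^bsub>Zp p\<^esub> \<in> carrier (Zp p)"
        by (rule zero_closed)
    qed (use False in \<open>auto simp: nat mod_simps\<close>)
    finally show ?thesis .
  qed
qed

lemma Zp_poly_eq:
  assumes p: "p > 0" and y: "y \<in> carrier (Zp p)"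
  shows "Zp_poly p P y = (\<lambda>n. poly P (y n) mod int p ^ n)"
proof -
  interpret cring "Zp p" by (rule Zp_cring[OF p])
  have cl: "[c] \<cdot>\<^bsub>Zp p\<^esub> (y [^]\<^bsub>Zp p\<^esub> (i::nat)) \<in> carrier (Zp p)" for c :: int and i
    using y by (simp del: Zp_simps)
  have term_eq: "[c] \<cdot>\<^bsub>Zp p\<^esub> (y [^]\<^bsub>Zp p\<^esub> (i::nat)) = (\<lambda>n. (c * y n ^ i) mod int p ^ n)"
    for c :: int and i
    using Zp_add_pow[OF p nat_pow_closed[OF y, of i], of c] by (simp add: Zp_power[OF p y] mod_simps)
  have "finsum (Zp p) (\<lambda>i. [coeff P i] \<cdot>\<^bsub>Zp p\<^esub> (y [^]\<^bsub>Zp p\<^esub> i)) A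
      = (\<lambda>n. (\<Sum>i\<in>A. coeff P i * y n ^ i) mod int p ^ n)" if "finite A" for A
    using that
  proof (induction A)
    case (insert a A)
    then show ?case
      using cl by (subst finsum_insert) (auto simp: term_eq mod_simps)
  qed simp
  then show ?thesis
    by (simp add: Zp_poly_def poly_altdef)
qed

instance int :: second_countable_topology
proof
  show "\<exists>B::int set set. countable B \<and> open = generate_topology B"
    by (intro exI[of _ "range lessThan \<union> range greaterThan"]) (auto simp: open_int_def)
qed

text \<open>The p-adic topology is that of the inverse limit, i.e. the subspace topology of the product
  of discrete spaces; this is the topology the library puts on \<^typ>\<open>nat \<Rightarrow> int\<close>.\<close>

definition Zp_borel :: "nat \<Rightarrow> (nat \<Rightarrow> int) measure" where
  "Zp_borel p = restrict_space borel (carrier (Zp p))"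

definition is_Zp_haar :: "nat \<Rightarrow> (nat \<Rightarrow> int) measure \<Rightarrow> bool" where
  "is_Zp_haar p \<nu> \<longleftrightarrow>
    sets \<nu> = sets (Zp_borel p) \<and> prob_space \<nu> \<and>
    (\<forall>a\<in>carrier (Zp p). \<forall>B\<in>sets \<nu>. emeasure \<nu> ((\<lambda>x. a \<oplus>\<^bsub>Zp p\<^esub> x) ` B) = emeasure \<nu> B)"

text \<open>Existence and uniqueness for \<open>p > 0\<close> are shown in \<open>ex1_Zp_haar\<close> below.\<close>

definition Zp_haar :: "nat \<Rightarrow> (nat \<Rightarrow> int) measure" where
  "Zp_haar p = (THE \<nu>. is_Zp_haar p \<nu>)"

definition Zp_cyl :: "nat \<Rightarrow> nat \<Rightarrow> int \<Rightarrow> (nat \<Rightarrow> int) set" where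
  "Zp_cyl p n r = {x \<in> carrier (Zp p). x n = r}"

lemma space_Zp_borel [simp]: "space (Zp_borel p) = carrier (Zp p)"
  by (simp add: Zp_borel_def space_restrict_space)

lemma Zp_mod_le:
  assumes "x \<in> carrier (Zp p)" "n \<le> m"
  shows "x m mod int p ^ n = x n"
  using assms(2)
proof (induction m rule: dec_induct)
  case (step m)
  have "x (Suc m) mod int p ^ n = (x (Suc m) mod int p ^ m) mod int p ^ n"
    using step by (simp add: mod_mod_cancel le_imp_power_dvd)
  then show ?case
    using step by (simp add: Zp_mod_Suc[OF assms(1)])
qed (simp add: Zp_carrier_mod[OF assms(1)])

lemma Zp_cyl_Int:
  assumes "n \<le> m"
  shows "Zp_cyl p n r \<inter> Zp_cyl p m s = (if s mod int p ^ n = r then Zp_cyl p m s else {})"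
  using Zp_mod_le[OF _ assms] by (auto simp: Zp_cyl_def)

lemma Int_stable_Zp_cyl: "Int_stable (insert {} {Zp_cyl p n r | n r. True})"
proof -
  have *: "Zp_cyl p n r \<inter> Zp_cyl p m s \<in> insert {} {Zp_cyl p n r | n r. True}" if "n \<le> m" for n r m s
    unfolding Zp_cyl_Int[OF that] by auto
  have "Zp_cyl p n r \<inter> Zp_cyl p m s \<in> insert {} {Zp_cyl p n r | n r. True}" for n r m s
    using *[of n m r s] *[of m n s r] nat_le_linear[of n m] unfolding Int_commute[of "Zp_cyl p m s"]
    by blast
  then show ?thesis
    unfolding Int_stable_def by (smt (verit) Int_empty_left Int_empty_right insert_iff mem_Collect_eq)
qed

lemma measurable_component_Zp [measurable]: "(\<lambda>x. x n) \<in> measurable (Zp_borel p) borel"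
proof -
  have "(\<lambda>x::nat \<Rightarrow> int. x n) \<in> borel_measurable borel"
    by (rule borel_measurable_continuous_onI) simp
  then show ?thesis
    unfolding Zp_borel_def by (rule measurable_restrict_space1)
qed

lemma Zp_cyl_sets [measurable]: "Zp_cyl p n r \<in> sets (Zp_borel p)"
proof -
  have "{x \<in> space (Zp_borel p). x n = r} \<in> sets (Zp_borel p)"
    by measurable
  then show ?thesis
    by (simp add: Zp_cyl_def)
qed

lemma sets_Zp_borel:
  "sets (Zp_borel p) = sigma_sets (carrier (Zp p)) (insert {} {Zp_cyl p n r | n r. True})"
    (is "_ = sigma_sets ?Z ?E")
proof
  have sub: "?E \<subseteq> Pow ?Z"
    by (auto simp: Zp_cyl_def)
  show "sigma_sets ?Z ?E \<subseteq> sets (Zp_borel p)"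
    using sets.sigma_sets_subset[of ?E "Zp_borel p"] Zp_cyl_sets by fastforce
  let ?N = "sigma ?Z ?E"
  have m: "(\<lambda>x. x) \<in> measurable ?N (borel :: (nat \<Rightarrow> int) measure)"
  proof (rule measurable_coordinatewise_then_product)
    fix n :: nat
    show "(\<lambda>x. x n) \<in> measurable ?N borel"
    proof (rule measurableI)
      fix A :: "int set"
      have "(\<lambda>x. x n) -` A \<inter> space ?N = (\<Union>r\<in>A. Zp_cyl p n r)"
        using sub by (auto simp: Zp_cyl_def)
      also have "\<dots> \<in> sets ?N"
        using sub by (intro sets.countable_UN') auto
      finally show "(\<lambda>x. x n) -` A \<inter> space ?N \<in> sets ?N" .
    qed simp
  qed
  show "sets (Zp_borel p) \<subseteq> sigma_sets ?Z ?E"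
  proof
    fix B assume "B \<in> sets (Zp_borel p)"
    then obtain A :: "(nat \<Rightarrow> int) set" where "A \<in> sets borel" "B = ?Z \<inter> A"
      by (auto simp: Zp_borel_def sets_restrict_space)
    then show "B \<in> sigma_sets ?Z ?E"
      using measurable_sets[OF m, of A] sub by (simp add: Int_commute)
  qed
qed

lemma Zp_measure_eqI:
  assumes "sets M = sets (Zp_borel p)" "sets N = sets (Zp_borel p)"
    and "\<And>n r. emeasure M (Zp_cyl p n r) = emeasure N (Zp_cyl p n r)"
    and "finite_measure M" "p > 0"
  shows "M = N"
proof (rule measure_eqI_generator_eq[OF Int_stable_Zp_cyl])
  have "Zp_cyl p 0 0 = carrier (Zp p)"
    by (auto simp: Zp_cyl_def Zp_carrier_iff) (metis less_one linorder_not_less order_antisym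
        power_0 zless_imp_add1_zle add_0)
  then show "(\<Union>i::nat. Zp_cyl p 0 0) = carrier (Zp p)"
    by simp
  show "emeasure M (Zp_cyl p 0 0) \<noteq> \<infinity>"
    using assms(4) by (simp add: finite_measure.emeasure_finite)
qed (use assms in \<open>auto simp: sets_Zp_borel Zp_cyl_def\<close>)

lemma Zp_of_int:
  assumes "p > 0"
  shows "(\<lambda>n. c mod int p ^ n) \<in> carrier (Zp p)"
  by (rule Zp_carrierI[OF assms refl refl])

lemma Zp_translate_cyl:
  assumes p: "p > 0" and a: "a \<in> carrier (Zp p)" and r: "r \<in> {0..<int p ^ n}"
  shows "(\<lambda>x. a \<oplus>\<^bsub>Zp p\<^esub> x) ` Zp_cyl p n r = Zp_cyl p n ((a n + r) mod int p ^ n)"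
proof (intro equalityI subsetI)
  fix y assume y: "y \<in> Zp_cyl p n ((a n + r) mod int p ^ n)"
  let ?x = "\<lambda>n. (y n - a n) mod int p ^ n"
  have y': "y \<in> carrier (Zp p)"
    using y by (simp add: Zp_cyl_def)
  then have "?x \<in> carrier (Zp p)" "a \<oplus>\<^bsub>Zp p\<^esub> ?x = y"
    using a p by (auto simp: Zp_closed mod_simps Zp_carrier_mod[OF y'])
  moreover have "?x n = r"
    using y r by (simp add: Zp_cyl_def mod_simps)
  ultimately show "y \<in> (\<lambda>x. a \<oplus>\<^bsub>Zp p\<^esub> x) ` Zp_cyl p n r"
    by (auto simp: Zp_cyl_def image_iff intro!: bexI[of _ ?x])
qed (use a p in \<open>auto simp: Zp_cyl_def Zp_closed\<close>)

lemma one_divide_ennreal_pow: "p > 0 \<Longrightarrow> 1 / ennreal (real p ^ n) = ennreal (1 / real p ^ n)"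
  using divide_ennreal[of 1 "real p ^ n"] by (simp only: ennreal_1 zero_le_one zero_less_power of_nat_0_less_iff)

lemma is_Zp_haar_cyl:
  assumes p: "p > 0" and "is_Zp_haar p \<nu>" and r: "r \<in> {0..<int p ^ n}"
  shows "emeasure \<nu> (Zp_cyl p n r) = 1 / ennreal (real p ^ n)"
proof -
  have s: "sets \<nu> = sets (Zp_borel p)" and "prob_space \<nu>"
    and inv: "\<And>a B. a \<in> carrier (Zp p) \<Longrightarrow> B \<in> sets \<nu> \<Longrightarrow>
      emeasure \<nu> ((\<lambda>x. a \<oplus>\<^bsub>Zp p\<^esub> x) ` B) = emeasure \<nu> B"
    using assms by (auto simp: is_Zp_haar_def)
  interpret prob_space \<nu> by fact
  have sp: "space \<nu> = carrier (Zp p)"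
    using sets_eq_imp_space_eq[OF s] by simp
  have eq: "emeasure \<nu> (Zp_cyl p n c) = emeasure \<nu> (Zp_cyl p n 0)" if "c \<in> {0..<int p ^ n}" for c
    using inv[OF Zp_of_int[OF p, of c], of "Zp_cyl p n 0"]
      Zp_translate_cyl[OF p Zp_of_int[OF p, of c], of 0 n] that p s
    by simp
  have "1 = emeasure \<nu> (\<Union>c\<in>{0..<int p ^ n}. Zp_cyl p n c)"
  proof -
    have "(\<Union>c\<in>{0..<int p ^ n}. Zp_cyl p n c) = space \<nu>"
      by (auto simp: sp Zp_cyl_def Zp_carrier_iff)
    then show ?thesis
      by (simp add: emeasure_space_1)
  qed
  also have "\<dots> = (\<Sum>c\<in>{0..<int p ^ n}. emeasure \<nu> (Zp_cyl p n c))"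
    by (rule sum_emeasure[symmetric]) (use Zp_cyl_sets in \<open>auto simp: s disjoint_family_on_def\<close>,
        auto simp: Zp_cyl_def)
  also have "\<dots> = (\<Sum>c\<in>{0..<int p ^ n}. emeasure \<nu> (Zp_cyl p n r))"
    by (rule sum.cong[OF refl]) (metis eq r)
  also have "\<dots> = of_nat (p ^ n) * emeasure \<nu> (Zp_cyl p n r)"
    by (simp add: nat_power_eq)
  finally have "1 = ennreal (real p ^ n * measure \<nu> (Zp_cyl p n r))"
    unfolding emeasure_eq_measure ennreal_of_nat_eq_real_of_nat of_nat_power
    by (subst ennreal_mult) simp_all
  then have "real p ^ n * measure \<nu> (Zp_cyl p n r) = 1"
    by (metis ennreal_eq_1)
  then have "measure \<nu> (Zp_cyl p n r) = 1 / real p ^ n"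
    using p by (simp add: field_simps)
  then show ?thesis
    unfolding emeasure_eq_measure one_divide_ennreal_pow[OF p] by (rule arg_cong)
qed

lemma Zp_cyl_empty: "r \<notin> {0..<int p ^ n} \<Longrightarrow> Zp_cyl p n r = {}"
  by (auto simp: Zp_cyl_def Zp_carrier_iff)

lemma measurable_Zp_borelI:
  assumes "\<And>x. x \<in> space M \<Longrightarrow> f x \<in> carrier (Zp p)"
    and "\<And>n. (\<lambda>x. f x n) \<in> measurable M borel"
  shows "f \<in> measurable M (Zp_borel p)"
  unfolding Zp_borel_def
proof (rule measurable_restrict_space2)
  show "f \<in> measurable M borel"
    by (rule measurable_coordinatewise_then_product) (use assms in auto)
qed (use assms in auto)

lemma is_Zp_haarI:
  assumes p: "p > 0" and s: "sets \<nu> = sets (Zp_borel p)" and "prob_space \<nu>"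
    and cyl: "\<And>n r. r \<in> {0..<int p ^ n} \<Longrightarrow> emeasure \<nu> (Zp_cyl p n r) = 1 / ennreal (real p ^ n)"
  shows "is_Zp_haar p \<nu>"
  unfolding is_Zp_haar_def
proof (intro conjI ballI s)
  interpret prob_space \<nu> by fact
  have sp: "space \<nu> = carrier (Zp p)"
    using sets_eq_imp_space_eq[OF s] by simp
  fix a B assume a: "a \<in> carrier (Zp p)" and B: "B \<in> sets \<nu>"
  define t where "t = (\<lambda>x n. (x n - a n) mod int p ^ n)"
  have [measurable]: "(\<lambda>x. x n) \<in> measurable \<nu> borel" for n
    by (simp add: measurable_cong_sets[OF s refl])
  have t: "t \<in> measurable \<nu> (Zp_borel p)"
  proof (rule measurable_Zp_borelI)
    fix n
    have "(\<lambda>x. (x - a n) mod int p ^ n) \<in> measurable borel borel"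
      by (rule borel_measurable_continuous_onI) (simp add: continuous_on_discrete)
    from measurable_compose[OF _ this, of "\<lambda>x. x n" \<nu>]
    show "(\<lambda>x. t x n) \<in> measurable \<nu> borel"
      by (simp add: t_def)
  qed (use p a in \<open>auto simp: sp t_def Zp_closed\<close>)
  have pre: "t -` A \<inter> carrier (Zp p) = (\<lambda>x. a \<oplus>\<^bsub>Zp p\<^esub> x) ` A" if A: "A \<subseteq> carrier (Zp p)" for A
  proof (intro equalityI subsetI)
    fix y assume y: "y \<in> t -` A \<inter> carrier (Zp p)"
    then have "y = a \<oplus>\<^bsub>Zp p\<^esub> t y"
      using Zp_carrier_mod[of y p] by (auto simp: t_def mod_simps)
    then show "y \<in> (\<lambda>x. a \<oplus>\<^bsub>Zp p\<^esub> x) ` A"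
      using y by blast
  next
    fix y assume "y \<in> (\<lambda>x. a \<oplus>\<^bsub>Zp p\<^esub> x) ` A"
    then obtain x where x: "x \<in> A" "x \<in> carrier (Zp p)" and y: "y = a \<oplus>\<^bsub>Zp p\<^esub> x"
      using A by blast
    have "t y = x"
      using Zp_carrier_mod[OF x(2)] by (auto simp: t_def y mod_simps)
    then show "y \<in> t -` A \<inter> carrier (Zp p)"
      using x a p by (auto simp: y Zp_closed)
  qed
  have "\<nu> = distr \<nu> (Zp_borel p) t"
  proof (rule Zp_measure_eqI)
    fix n r
    have *: "emeasure (distr \<nu> (Zp_borel p) t) (Zp_cyl p n r)
        = emeasure \<nu> ((\<lambda>x. a \<oplus>\<^bsub>Zp p\<^esub> x) ` Zp_cyl p n r)"
      by (subst emeasure_distr[OF t Zp_cyl_sets]) (subst sp, subst pre, auto simp: Zp_cyl_def)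
    show "emeasure \<nu> (Zp_cyl p n r) = emeasure (distr \<nu> (Zp_borel p) t) (Zp_cyl p n r)"
    proof (cases "r \<in> {0..<int p ^ n}")
      case True
      then show ?thesis
        unfolding * Zp_translate_cyl[OF p a True] using p by (subst (1 2) cyl) auto
    qed (simp add: * Zp_cyl_empty)
  qed (use s p in \<open>auto simp: finite_measure_axioms\<close>)
  then have "emeasure \<nu> B = emeasure (distr \<nu> (Zp_borel p) t) B"
    by simp
  also have "\<dots> = emeasure \<nu> (t -` B \<inter> carrier (Zp p))"
    using B by (simp add: emeasure_distr[OF t] s sp)
  also have "t -` B \<inter> carrier (Zp p) = (\<lambda>x. a \<oplus>\<^bsub>Zp p\<^esub> x) ` B"
    using sets.sets_into_space[OF B] by (intro pre) (simp add: sp)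
  finally show "emeasure \<nu> ((\<lambda>x. a \<oplus>\<^bsub>Zp p\<^esub> x) ` B) = emeasure \<nu> B" ..
qed fact

lemma digit_sum_less:
  assumes "\<And>i. d i \<in> {0..<int p}"
  shows "(\<Sum>i<n. d i * int p ^ i) \<in> {0..<int p ^ n}"
proof (induction n)
  case (Suc n)
  have "(d n + 1) * int p ^ n \<le> int p * int p ^ n"
    using assms[of n] by (intro mult_right_mono) auto
  then show ?case
    using Suc assms[of n] by (auto simp: algebra_simps)
qed simp

lemma digit_sum_eq:
  assumes p: "p > 0" and "r \<in> {0..<int p ^ n}"
  shows "\<exists>c. (\<forall>i. c i \<in> {0..<int p}) \<and>
    (\<forall>d. (\<forall>i. d i \<in> {0..<int p}) \<longrightarrow> ((\<Sum>i<n. d i * int p ^ i) = r \<longleftrightarrow> (\<forall>i<n. d i = c i)))"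
  using assms(2)
proof (induction n arbitrary: r)
  case 0
  then show ?case
    using p by (intro exI[of _ "\<lambda>_. 0"]) auto
next
  case (Suc n)
  have "r mod int p ^ n \<in> {0..<int p ^ n}"
    using p by simp
  from Suc.IH[OF this] obtain c where c: "\<And>i. c i \<in> {0..<int p}"
    and eq: "\<And>d. (\<And>i. d i \<in> {0..<int p}) \<Longrightarrow>
      (\<Sum>i<n. d i * int p ^ i) = r mod int p ^ n \<longleftrightarrow> (\<forall>i<n. d i = c i)"
    by blast
  have q: "r div int p ^ n \<in> {0..<int p}"
  proof -
    have "r < int p * int p ^ n"
      using Suc.prems by simp
    moreover have "r div int p ^ n * int p ^ n \<le> r"
    proof -
      have "0 \<le> r mod int p ^ n"
        using p by simp
      then show ?thesis
        using div_mult_mod_eq[of r "int p ^ n"] by linarith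
    qed
    ultimately have "r div int p ^ n * int p ^ n < int p * int p ^ n"
      by linarith
    then have "r div int p ^ n < int p"
      by (rule mult_right_less_imp_less) simp
    then show ?thesis
      using Suc.prems p by (simp add: pos_imp_zdiv_nonneg_iff)
  qed
  show ?case
  proof (intro exI[of _ "c(n := r div int p ^ n)"] conjI allI impI)
    fix d :: "nat \<Rightarrow> int" assume "\<forall>i. d i \<in> {0..<int p}"
    then have d: "\<And>i. d i \<in> {0..<int p}"
      by blast
    let ?s = "\<Sum>i<n. d i * int p ^ i"
    have s: "?s \<in> {0..<int p ^ n}"
      by (rule digit_sum_less[OF d])
    have "?s + d n * int p ^ n = r \<longleftrightarrow> ?s = r mod int p ^ n \<and> d n = r div int p ^ n"
    proof
      assume "?s + d n * int p ^ n = r"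
      then show "?s = r mod int p ^ n \<and> d n = r div int p ^ n"
        using s p by auto
    qed (simp add: mult.commute)
    then show "(\<Sum>i<Suc n. d i * int p ^ i) = r \<longleftrightarrow> (\<forall>i<Suc n. d i = (c(n := r div int p ^ n)) i)"
      by (auto simp: eq[OF d] less_Suc_eq)
  qed (use c q in auto)
qed

lemma ex_Zp_haar:
  assumes p: "p > 0"
  shows "\<exists>\<nu>. is_Zp_haar p \<nu>"
proof -
  define U where "U = uniform_count_measure {0..<int p}"
  define D where "D = PiM UNIV (\<lambda>_::nat. U)"
  define S where "S = (\<lambda>d n. \<Sum>i<n. d i * int p ^ i)"
  have "prob_space U"
    unfolding U_def using p by (intro prob_space_uniform_count_measure) auto
  then interpret product_prob_space "\<lambda>_::nat. U" UNIV
    by (simp add: product_prob_space_def product_prob_space_axioms_def product_sigma_finite_def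
        prob_space_imp_sigma_finite)
  have spD: "space D = {d. \<forall>i. d i \<in> {0..<int p}}"
    by (auto simp: D_def space_PiM U_def space_uniform_count_measure PiE_def Pi_iff)
  have S: "S \<in> measurable D (Zp_borel p)"
  proof (rule measurable_Zp_borelI)
    fix d assume "d \<in> space D"
    then have d: "d i \<in> {0..<int p}" for i
      by (auto simp: spD)
    show "S d \<in> carrier (Zp p)"
      using digit_sum_less[OF d] by (auto simp: Zp_carrier_iff S_def)
  next
    fix n
    have [measurable]: "(\<lambda>d. d i) \<in> measurable D borel" for i
    proof -
      have "(\<lambda>d. d i) \<in> measurable D U"
        unfolding D_def by (rule measurable_component_singleton) simp
      moreover have "(\<lambda>x. x) \<in> measurable U borel"
        by (rule measurableI) (auto simp: U_def sets_uniform_count_measure space_uniform_count_measure)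
      ultimately show ?thesis
        by (rule measurable_compose)
    qed
    have [measurable]: "(\<lambda>d. d i * int p ^ i) \<in> measurable D borel" for i
    proof -
      have "(\<lambda>x. x * int p ^ i) \<in> measurable borel borel"
        by (rule borel_measurable_continuous_onI) (simp add: continuous_on_discrete)
      then show ?thesis
        by (rule measurable_compose[rotated]) measurable
    qed
    show "(\<lambda>d. S d n) \<in> measurable D borel"
      unfolding S_def by (rule borel_measurable_sum) measurable
  qed
  have "is_Zp_haar p (distr D (Zp_borel p) S)"
  proof (rule is_Zp_haarI[OF p])
    have "prob_space D"
      unfolding D_def by (rule prob_space_axioms)
    then show "prob_space (distr D (Zp_borel p) S)"
      by (rule prob_space.prob_space_distr[OF _ S])
    fix n r assume r: "r \<in> {0..<int p ^ n}"
    obtain c where c: "\<And>i. c i \<in> {0..<int p}"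
      and eq: "\<And>d. (\<And>i. d i \<in> {0..<int p}) \<Longrightarrow> S d n = r \<longleftrightarrow> (\<forall>i<n. d i = c i)"
      unfolding S_def using digit_sum_eq[OF p r] by blast
    have eq': "S d n = r \<longleftrightarrow> (\<forall>i<n. d i = c i)" if "d \<in> space D" for d
      by (rule eq) (use that spD in blast)
    have "S -` Zp_cyl p n r \<inter> space D = {d \<in> space D. \<forall>i\<in>{..<n}. d i \<in> {c i}}"
      using measurable_space[OF S] eq' by (auto simp: Zp_cyl_def)
    then have "emeasure (distr D (Zp_borel p) S) (Zp_cyl p n r)
        = emeasure D {d \<in> space D. \<forall>i\<in>{..<n}. d i \<in> {c i}}"
      by (simp add: emeasure_distr[OF S Zp_cyl_sets])
    also have "\<dots> = (\<Prod>i<n. emeasure U {c i})"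
      unfolding D_def using c
      by (intro emeasure_PiM_Collect) (auto simp: U_def sets_uniform_count_measure)
    also have "\<dots> = (\<Prod>i<n. ennreal (1 / real p))"
      using c p by (intro prod.cong) (auto simp: U_def emeasure_uniform_count_measure)
    also have "\<dots> = 1 / ennreal (real p ^ n)"
      unfolding one_divide_ennreal_pow[OF p]
      by (simp only: prod_constant card_lessThan ennreal_power power_divide power_one
          zero_le_divide_1_iff of_nat_0_le_iff)
    finally show "emeasure (distr D (Zp_borel p) S) (Zp_cyl p n r) = 1 / ennreal (real p ^ n)" .
  qed simp
  then show ?thesis ..
qed

lemma ex1_Zp_haar:
  assumes p: "p > 0"
  shows "\<exists>!\<nu>. is_Zp_haar p \<nu>"
proof (rule ex_ex1I[OF ex_Zp_haar[OF p]])
  fix \<mu> \<nu> assume h: "is_Zp_haar p \<mu>" "is_Zp_haar p \<nu>"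
  then have "sets \<mu> = sets (Zp_borel p)" "sets \<nu> = sets (Zp_borel p)" "finite_measure \<mu>"
    by (auto simp: is_Zp_haar_def prob_space_def)
  moreover have "emeasure \<mu> (Zp_cyl p n r) = emeasure \<nu> (Zp_cyl p n r)" for n r
    using is_Zp_haar_cyl[OF p h(1), of r n] is_Zp_haar_cyl[OF p h(2), of r n] Zp_cyl_empty[of r p n]
    by (cases "r \<in> {0..<int p ^ n}") auto
  ultimately show "\<mu> = \<nu>"
    using p by (intro Zp_measure_eqI)
qed

lemma is_Zp_haar_Zp_haar: "p > 0 \<Longrightarrow> is_Zp_haar p (Zp_haar p)"
  unfolding Zp_haar_def by (rule theI'[OF ex1_Zp_haar])

text \<open>The exponent \<open>q\<close> ranges over \<open>[1, \<infinity>]\<close>; a norm is \<open>\<infinity>\<close> outside the corresponding space.\<close>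

definition Lq_norm :: "'a measure \<Rightarrow> ennreal \<Rightarrow> ('a \<Rightarrow> complex) \<Rightarrow> ennreal" where
  "Lq_norm M q f =
    (if q = \<infinity> then esssup M (\<lambda>x. ennreal (norm (f x)))
     else let I = (\<integral>\<^sup>+ x. ennreal (norm (f x) powr enn2real q) \<partial>M)
          in if I = \<infinity> then \<infinity> else ennreal (enn2real I powr (1 / enn2real q)))"

definition Lq_space :: "'a measure \<Rightarrow> ennreal \<Rightarrow> ('a \<Rightarrow> complex) set" where
  "Lq_space M q = {f \<in> borel_measurable M. Lq_norm M q f < \<infinity>}"

definition Zp_integrand ::
    "nat \<Rightarrow> nat \<Rightarrow> (nat \<Rightarrow> int poly) \<Rightarrow> (nat \<Rightarrow> (nat \<Rightarrow> int) \<Rightarrow> complex) \<Rightarrow> (nat \<Rightarrow> int) \<Rightarrow> (nat \<Rightarrow> int) \<Rightarrow> complex"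
  where
  "Zp_integrand p k P f x y = (\<Prod>i\<in>{1..k}. f i (x \<ominus>\<^bsub>Zp p\<^esub> Zp_poly p (P i) y))"

definition Zp_avg ::
    "nat \<Rightarrow> nat \<Rightarrow> (nat \<Rightarrow> int poly) \<Rightarrow> (nat \<Rightarrow> (nat \<Rightarrow> int) \<Rightarrow> complex) \<Rightarrow> (nat \<Rightarrow> int) \<Rightarrow> complex" where
  "Zp_avg p k P f x = (\<integral>y. Zp_integrand p k P f x y \<partial>Zp_haar p)"

text \<open>The Bochner integral is \<open>0\<close> where the integrand is not integrable, so an admissible constant
  is also required to come with absolute convergence of the defining integral almost everywhere.\<close>

definition Zp_avg_bounded_by ::
    "nat \<Rightarrow> nat \<Rightarrow> (nat \<Rightarrow> int poly) \<Rightarrow> (nat \<Rightarrow> ennreal) \<Rightarrow> ennreal \<Rightarrow> ennreal \<Rightarrow> bool" where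
  "Zp_avg_bounded_by p k P qs q C \<longleftrightarrow>
    (\<forall>f. (\<forall>i\<in>{1..k}. f i \<in> Lq_space (Zp_haar p) (qs i)) \<longrightarrow>
      (AE x in Zp_haar p. integrable (Zp_haar p) (Zp_integrand p k P f x)) \<and>
      Zp_avg p k P f \<in> borel_measurable (Zp_haar p) \<and>
      Lq_norm (Zp_haar p) q (Zp_avg p k P f) \<le> C * (\<Prod>i\<in>{1..k}. Lq_norm (Zp_haar p) (qs i) (f i)))"

definition Zp_avg_norm ::
    "nat \<Rightarrow> nat \<Rightarrow> (nat \<Rightarrow> int poly) \<Rightarrow> (nat \<Rightarrow> ennreal) \<Rightarrow> ennreal \<Rightarrow> ennreal" where
  "Zp_avg_norm p k P qs q = Inf {C. Zp_avg_bounded_by p k P qs q C}"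

end

theory Submission
  imports Defs
begin

text \<open>
  The bound holds pointwise in \<open>x\<close>, with a constant depending on the polynomials and the exponents
  only; since \<open>\<int>\<^sub>p\<close> has total mass 1, a uniform bound is a bound in every \<open>L\<^sup>q\<close>. Normalise each
  \<open>f i\<close> to norm at most 1. A product of \<open>k\<close> nonnegative numbers is at most the sum of their \<open>k\<close>-th
  powers, so it suffices to bound \<open>\<integral> g (x - P y) dy\<close> for a single polynomial \<open>P\<close>, of degree \<open>d\<close>,
  where \<open>g = |f i|^k\<close> lies in the unit ball of \<open>L\<^sup>s\<close> for \<open>s = qs i / k > d + 1\<close>.

  Only the critical points of \<open>P\<close> keep the image of Haar measure under \<open>y \<mapsto> x - P y\<close> from having
  a bounded density. On the set \<open>E m\<close> where \<open>P' y\<close> has absolute value exactly \<open>p^(-m)\<close>, two facts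
  compete. First, \<open>E m\<close> is small: its measure is \<open>O(p^(-m/d))\<close> (\<open>measure_crit_level_le\<close>).
  Second, the image of Haar measure on \<open>E m\<close> has density at most \<open>d p^m\<close>, because \<open>P\<close> has at most
  \<open>d\<close> branches there, each of which scales volume by \<open>p^(-m)\<close> (\<open>nn_integral_crit_level_le\<close>).
  Splitting \<open>g\<close> at the height \<open>t = p^(c m)\<close> by means of \<open>g \<le> t + t^(1-s) g^s\<close> bounds the integral
  over \<open>E m\<close> by a constant times \<open>p^(-m (1/d - c)) + p^(-m (c (s-1) - 1))\<close>. Both exponents are
  negative as soon as \<open>1/(s-1) < c < 1/d\<close>, and such a \<open>c\<close> exists because \<open>s > d + 1\<close>. The sum over
  \<open>m\<close> is then dominated by the geometric series with \<open>p = 2\<close>; this is where the constant becomes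
  independent of \<open>p\<close> (\<open>pushforward_bound\<close>).

  Both facts about \<open>E m\<close> rest on interpolation (\<open>separated_roots_dvd_coeff\<close>): a polynomial of degree
  at most \<open>d\<close> can be \<open>p\<close>-adically small at \<open>d + 1\<close> well separated points only if its coefficient
  of degree \<open>d\<close> is. The prime enters through the absolute value of that integer coefficient only,
  and \<open>p^v \<le> |a|\<close> whenever \<open>p^v\<close> divides \<open>a \<noteq> 0\<close>.
\<close>

section \<open>Polynomials small at separated points\<close>

lemma prime_power_dvd_cancel:
  fixes p :: nat and h z :: int
  assumes p: "prime p" and h: "\<not> int p ^ Suc l dvd h" and d: "int p ^ m dvd K * (h * z)"
  shows "int p ^ m dvd K * (int p ^ l * z)"
proof -
  have pp: "prime (int p)" using p by simp
  have h0: "h \<noteq> 0" using h by auto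
  obtain u where u: "h = int p ^ multiplicity (int p) h * u" "\<not> int p dvd u"
    using multiplicity_decompose'[of h "int p"] h0 pp prime_gt_1_nat[OF p] by auto
  let ?j = "multiplicity (int p) h"
  have "?j \<le> l"
    using h u(1) by (metis dvd_trans dvd_triv_left le_imp_power_dvd not_less_eq_eq)
  then obtain i where l: "l = ?j + i" using le_Suc_ex by blast
  have "int p ^ m dvd u * (K * (int p ^ ?j * z))"
    using d by (subst (asm) u(1)) (simp add: mult_ac)
  moreover have "coprime (int p ^ m) u"
    using pp u(2) by (simp add: prime_imp_coprime)
  ultimately have "int p ^ m dvd K * (int p ^ ?j * z)"
    using coprime_dvd_mult_right_iff by blast
  then have "int p ^ m dvd K * (int p ^ ?j * z) * int p ^ i" by (rule dvd_mult2)
  then show ?thesis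
    by (subst l) (simp add: power_add mult_ac)
qed

text \<open>
  Newton's divided differences, one node at a time: dividing \<open>Q y - Q y0\<close> by \<open>y - y0\<close> lowers the
  degree, keeps the top coefficient, and costs at most \<open>l\<close> factors \<open>p\<close> since \<open>y - y0\<close> is not divisible
  by \<open>p^(l+1)\<close>. The multiplier \<open>K\<close> accumulates these costs in the induction, in place of
  a truncated subtraction in the exponent of \<open>p^m\<close>.
\<close>

lemma separated_roots_dvd_coeff:
  fixes p :: nat and Q :: "int poly"
  assumes p: "prime p"
    and "finite S" "card S = Suc e" "degree Q \<le> e"
    and "\<And>x y. x \<in> S \<Longrightarrow> y \<in> S \<Longrightarrow> x \<noteq> y \<Longrightarrow> \<not> int p ^ Suc l dvd x - y"
    and "\<And>y. y \<in> S \<Longrightarrow> int p ^ m dvd K * poly Q y"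
  shows "int p ^ m dvd K * (int p ^ (l * e) * coeff Q e)"
  using assms(2-)
proof (induction e arbitrary: S Q K)
  case 0
  then obtain y where "y \<in> S" by fastforce
  with 0 show ?case by (auto elim!: degree_eq_zeroE)
next
  case (Suc e)
  then obtain y0 where y0: "y0 \<in> S" by fastforce
  define R where "R = synthetic_div Q y0"
  have Q: "Q + smult y0 R = pCons (poly Q y0) R"
    unfolding R_def by (rule synthetic_div_correct)
  have dR: "degree R \<le> e"
    using Suc.prems by (simp add: R_def degree_synthetic_div)
  have "coeff (Q + smult y0 R) (Suc e) = coeff R e"
    unfolding Q by simp
  then have cR: "coeff R e = coeff Q (Suc e)"
    using dR by (simp add: coeff_eq_0)
  have Qy: "poly Q y - poly Q y0 = (y - y0) * poly R y" for y
    using arg_cong[OF Q, of "\<lambda>r. poly r y"] by (simp add: algebra_simps)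
  have "int p ^ m dvd (K * int p ^ l) * (int p ^ (l * e) * coeff R e)"
  proof (rule Suc.IH)
    fix y assume y: "y \<in> S - {y0}"
    have "int p ^ m dvd K * poly Q y - K * poly Q y0"
      using Suc.prems y y0 by (intro dvd_diff) auto
    then have "int p ^ m dvd K * ((y - y0) * poly R y)"
      by (simp add: Qy[symmetric] right_diff_distrib)
    from prime_power_dvd_cancel[OF p _ this, of l]
    show "int p ^ m dvd (K * int p ^ l) * poly R y"
      using Suc.prems(4)[of y y0] y y0 by (simp add: mult_ac)
  qed (use Suc.prems y0 dR in auto)
  then show ?case
    by (simp add: cR power_add mult_ac)
qed

lemma card_residues_le:
  fixes p :: nat and Q :: "int poly"
  assumes p: "prime p" and dQ: "degree Q \<le> e"
    and T: "\<And>y. y \<in> T \<Longrightarrow> int p ^ m dvd poly Q y"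
    and nd: "\<not> int p ^ m dvd int p ^ (l * e) * coeff Q e"
  shows "card ((\<lambda>y. y mod int p ^ Suc l) ` T) \<le> e"
proof (rule ccontr)
  assume "\<not> ?thesis"
  then have "Suc e \<le> card ((\<lambda>y. y mod int p ^ Suc l) ` T)" by simp
  then obtain R where R: "R \<subseteq> (\<lambda>y. y mod int p ^ Suc l) ` T" "card R = Suc e" "finite R"
    by (rule obtain_subset_with_card_n)
  from subset_image_inj[of R "\<lambda>y. y mod int p ^ Suc l" T] R(1)
  obtain S where S: "S \<subseteq> T" "inj_on (\<lambda>y. y mod int p ^ Suc l) S"
    "R = (\<lambda>y. y mod int p ^ Suc l) ` S" by blast
  have "int p ^ m dvd 1 * (int p ^ (l * e) * coeff Q e)"
  proof (rule separated_roots_dvd_coeff[OF p])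
    show "card S = Suc e" using S R by (simp add: card_image)
    show "finite S" using S R by (simp add: finite_image_iff)
    fix x y assume "x \<in> S" "y \<in> S" "x \<noteq> y"
    then show "\<not> int p ^ Suc l dvd x - y"
      using inj_onD[OF S(2)] by (auto simp: mod_eq_dvd_iff)
  qed (use dQ T S in auto)
  with nd show False by simp
qed

text \<open>
  The uniqueness half of Hensel's lemma: by Taylor expansion \<open>P y - P z = (y - z) (P' z + (y - z) v)\<close>,
  and for \<open>y\<close> this close to \<open>z\<close> the second factor, like \<open>P' z\<close>, is not divisible by \<open>p^(m+1)\<close>.
  Hence \<open>P\<close> shrinks the distance from \<open>z\<close> by at most a factor \<open>p^(-m)\<close>.
\<close>

lemma Hensel_separation:
  fixes p :: nat and P :: "int poly"
  assumes p: "prime p" and mn: "m \<le> n"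
    and y: "int p ^ n dvd poly P y - poly P z"
    and P': "\<not> int p ^ Suc m dvd poly (pderiv P) z"
    and yz: "int p ^ Suc m dvd y - z"
  shows "int p ^ (n - m) dvd y - z"
proof -
  define R where "R = synthetic_div P z"
  define V where "V = synthetic_div R z"
  have P: "P = [:-z, 1:] * R + [:poly P z:]" and R: "R = [:-z, 1:] * V + [:poly R z:]"
    unfolding R_def V_def by (simp_all only: synthetic_div_correct')
  have "pderiv P = pderiv ([:-z, 1:] * R + [:poly P z:])" using P by simp
  also have "\<dots> = [:-z, 1:] * pderiv R + R"
    by (simp only: pderiv_add pderiv_mult pderiv_pCons) simp
  finally have dP: "poly (pderiv P) z = poly R z" by simp
  have "poly P y = (y - z) * poly R y + poly P z"
    by (subst P) (simp add: algebra_simps)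
  moreover have "poly R y = (y - z) * poly V y + poly R z"
    by (subst R) (simp add: algebra_simps)
  ultimately have "poly P y - poly P z = (y - z) * poly R y"
    and Ry: "poly R y = (y - z) * poly V y + poly R z"
    by simp_all
  with y have d: "int p ^ n dvd 1 * (poly R y * (y - z))" by (simp add: mult.commute)
  have "\<not> int p ^ Suc m dvd poly R y"
    unfolding Ry using yz P' dP by (simp add: dvd_add_right_iff)
  from prime_power_dvd_cancel[OF p this d]
  have "int p ^ m * int p ^ (n - m) dvd int p ^ m * (y - z)"
    using mn by (simp add: power_add[symmetric])
  then show ?thesis using p by (simp add: prime_gt_0_nat)
qed

section \<open>Comparing measures on a generating algebra\<close>

text \<open>
  Every set of the generated \<open>\<sigma>\<close>-algebra is approximated by members of the algebra, up to a symmetric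
  difference that is small for both measures at once; the inequality passes to the limit.
\<close>

lemma measure_le_if_le_on_generating_algebra:
  assumes M: "finite_measure M" and N: "finite_measure N"
    and alg: "algebra \<Omega> A"
    and sM: "sets M = sigma_sets \<Omega> A" and sN: "sets N = sigma_sets \<Omega> A"
    and le: "\<And>a. a \<in> A \<Longrightarrow> measure M a \<le> c * measure N a"
    and c: "c \<ge> 0"
    and B: "B \<in> sets M"
  shows "measure M B \<le> c * measure N B"
proof -
  interpret M: finite_measure M by fact
  interpret N: finite_measure N by fact
  interpret algebra \<Omega> A by fact
  have sMN: "sets M = sets N" using sM sN by simp
  have AM: "A \<subseteq> sets M" unfolding sM by auto
  have spM: "space M = \<Omega>"
  proof (rule antisym)
    show "space M \<subseteq> \<Omega>"
      using sets.top[of M] sigma_sets_into_sp[OF space_closed] unfolding sM by blast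
    show "\<Omega> \<subseteq> space M"
      using sets.sets_into_space[of \<Omega> M] sigma_sets_top[of \<Omega> A] unfolding sM by blast
  qed
  \<comment> \<open>Measuring errors by the sum of both measures approximates for \<open>M\<close> and \<open>N\<close> simultaneously.\<close>
  define d where "d = (\<lambda>X. measure M X + measure N X)"
  have d_sub: "d X \<le> d Y + d Z" if "X \<subseteq> Y \<union> Z" "X \<in> sets M" "Y \<in> sets M" "Z \<in> sets M" for X Y Z
    using M.finite_measure_mono[OF that(1)] N.finite_measure_mono[OF that(1)]
      measure_Un_le[of Y M Z] measure_Un_le[of Y N Z] that sMN
    unfolding d_def by force
  define app where "app = (\<lambda>B. \<forall>e>0. \<exists>a\<in>A. d (sym_diff B a) < e)"
  have appU: "app (X \<union> Y)" if X: "app X" "X \<in> sets M" and Y: "app Y" "Y \<in> sets M" for X Y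
    unfolding app_def
  proof (intro allI impI)
    fix e :: real assume "e > 0"
    then obtain a b where a: "a \<in> A" "d (sym_diff X a) < e / 2" and b: "b \<in> A" "d (sym_diff Y b) < e / 2"
      using X Y unfolding app_def by (meson half_gt_zero)
    have "d (sym_diff (X \<union> Y) (a \<union> b)) \<le> d (sym_diff X a) + d (sym_diff Y b)"
      using a b X Y AM by (intro d_sub) auto
    then show "\<exists>a\<in>A. d (sym_diff (X \<union> Y) a) < e"
      using a b by (intro bexI[of _ "a \<union> b"]) auto
  qed
  have app: "app B" if "B \<in> sigma_sets \<Omega> A" for B
    using that
  proof (induction rule: sigma_sets.induct)
    case (Basic a)
    then show ?case by (auto simp: app_def d_def intro!: bexI[of _ a])
  next
    case Empty
    then show ?case by (auto simp: app_def d_def intro!: bexI[of _ "{}"])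
  next
    case (Compl a)
    have aO: "a \<subseteq> \<Omega>" using Compl(1) spM sM sets.sets_into_space by blast
    show ?case unfolding app_def
    proof (intro allI impI)
      fix e :: real assume "e > 0"
      then obtain b where b: "b \<in> A" "d (sym_diff a b) < e"
        using Compl.IH unfolding app_def by blast
      have "b \<subseteq> \<Omega>" using b space_closed by blast
      with aO have "sym_diff (\<Omega> - a) (\<Omega> - b) = sym_diff a b" by blast
      with b show "\<exists>b\<in>A. d (sym_diff (\<Omega> - a) b) < e"
        by (intro bexI[of _ "\<Omega> - b"]) auto
    qed
  next
    case (Union a)
    have aM [measurable]: "a i \<in> sets M" for i using Union sM by simp
    define b where "b = (\<lambda>n. \<Union>i<n. a i)"
    have bM [measurable]: "b n \<in> sets M" for n unfolding b_def by measurable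
    have appb: "app (b n)" for n
    proof (induction n)
      case 0
      then show ?case by (auto simp: app_def d_def b_def intro!: bexI[of _ "{}"])
    next
      case (Suc n)
      then show ?case using appU[of "a n" "b n"] Union.IH by (simp add: b_def lessThan_Suc)
    qed
    have Ub: "(\<Union>i. a i) = (\<Union>n. b n)" unfolding b_def by blast
    have inc: "incseq b" unfolding b_def incseq_def by fastforce
    have UM: "(\<Union>i. a i) \<in> sets M" by measurable
    have "(\<lambda>n. measure M (b n)) \<longlonglongrightarrow> measure M (\<Union>i. a i)"
      "(\<lambda>n. measure N (b n)) \<longlonglongrightarrow> measure N (\<Union>i. a i)"
      unfolding Ub using M.finite_Lim_measure_incseq[of b] N.finite_Lim_measure_incseq[of b] inc bM sMN
      by (auto simp: image_subset_iff)
    then have lim: "(\<lambda>n. d (\<Union>i. a i) - d (b n)) \<longlonglongrightarrow> d (\<Union>i. a i) - d (\<Union>i. a i)"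
      unfolding d_def by (intro tendsto_intros)
    show ?case unfolding app_def
    proof (intro allI impI)
      fix e :: real assume e: "e > 0"
      have "eventually (\<lambda>n. d (\<Union>i. a i) - d (b n) < e / 2) sequentially"
        by (rule order_tendstoD(2)[OF lim]) (use e in simp)
      then obtain n where n: "d (\<Union>i. a i) - d (b n) < e / 2"
        by (auto simp: eventually_sequentially)
      obtain x where x: "x \<in> A" "d (sym_diff (b n) x) < e / 2"
        using appb[of n] e unfolding app_def by (meson half_gt_zero)
      have bU: "b n \<subseteq> (\<Union>i. a i)" unfolding Ub by blast
      have "d ((\<Union>i. a i) - b n) = d (\<Union>i. a i) - d (b n)"
        unfolding d_def using bU UM bM sMN
        by (simp add: M.finite_measure_Diff N.finite_measure_Diff)
      moreover have "d (sym_diff (\<Union>i. a i) x) \<le> d ((\<Union>i. a i) - b n) + d (sym_diff (b n) x)"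
        using x AM UM bM bU by (intro d_sub) auto
      ultimately show "\<exists>x\<in>A. d (sym_diff (\<Union>i. a i) x) < e"
        using x n by (intro bexI[of _ x]) auto
    qed
  qed
  show ?thesis
  proof (rule field_le_epsilon)
    fix e :: real assume e: "e > 0"
    then have "e / (1 + c) > 0" using c by simp
    then obtain a where a: "a \<in> A" and da: "d (sym_diff B a) < e / (1 + c)"
      using app[of B] B sM unfolding app_def by blast
    have aM: "a \<in> sets M" using a AM by blast
    have "measure M B \<le> measure M a + d (sym_diff B a)"
    proof -
      have "measure M B \<le> measure M (a \<union> sym_diff B a)"
        using B aM by (intro M.finite_measure_mono) auto
      also have "\<dots> \<le> measure M a + measure M (sym_diff B a)"
        using B aM by (intro measure_Un_le) auto
      finally show ?thesis using measure_nonneg[of N "sym_diff B a"] unfolding d_def by linarith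
    qed
    also have "measure M a \<le> c * measure N a" by (rule le[OF a])
    also have "measure N a \<le> measure N B + d (sym_diff B a)"
    proof -
      have "measure N a \<le> measure N (B \<union> sym_diff B a)"
        using B aM sMN by (intro N.finite_measure_mono) auto
      also have "\<dots> \<le> measure N B + measure N (sym_diff B a)"
        using B aM sMN by (intro measure_Un_le) auto
      finally show ?thesis using measure_nonneg[of M "sym_diff B a"] unfolding d_def by linarith
    qed
    finally have "measure M B \<le> c * (measure N B + d (sym_diff B a)) + d (sym_diff B a)"
      using c by (simp add: mult_left_mono)
    also have "\<dots> = c * measure N B + (1 + c) * d (sym_diff B a)" by (simp add: algebra_simps)
    also have "(1 + c) * d (sym_diff B a) \<le> e"
      using da c by (simp add: field_simps)
    finally show "measure M B \<le> c * measure N B + e" by simp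
  qed
qed

section \<open>Haar measure and polynomial shifts\<close>

lemma sets_Zp_haar:
  assumes "p > 0"
  shows "sets (Zp_haar p) = sets (Zp_borel p)"
  using is_Zp_haar_Zp_haar[OF assms] by (simp add: is_Zp_haar_def)

lemma space_Zp_haar: "p > 0 \<Longrightarrow> space (Zp_haar p) = carrier (Zp p)"
  using sets_eq_imp_space_eq[OF sets_Zp_haar] by simp

lemma prob_space_Zp_haar: "p > 0 \<Longrightarrow> prob_space (Zp_haar p)"
  using is_Zp_haar_Zp_haar by (simp add: is_Zp_haar_def)

lemma measure_Zp_cyl:
  assumes p: "p > 0" and r: "r \<in> {0..<int p ^ n}"
  shows "measure (Zp_haar p) (Zp_cyl p n r) = 1 / real p ^ n"
  using is_Zp_haar_cyl[OF p is_Zp_haar_Zp_haar[OF p] r]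
  unfolding one_divide_ennreal_pow[OF p] measure_def by simp

lemma measure_le_card_residues:
  assumes p: "p > 0" and B: "B \<in> sets (Zp_haar p)" and card: "card ((\<lambda>x. x n) ` B) \<le> e"
  shows "measure (Zp_haar p) B \<le> real e / real p ^ n"
proof -
  interpret prob_space "Zp_haar p" by (rule prob_space_Zp_haar[OF p])
  let ?R = "(\<lambda>x. x n) ` B"
  have BZ: "B \<subseteq> carrier (Zp p)"
    using sets.sets_into_space[OF B] by (simp add: space_Zp_haar p)
  then have R: "?R \<subseteq> {0..<int p ^ n}"
    by (auto simp: Zp_carrier_iff)
  have finR: "finite ?R" by (rule finite_subset[OF R]) simp
  have cm: "Zp_cyl p n r \<in> sets (Zp_haar p)" for r
    by (simp add: sets_Zp_haar p Zp_cyl_sets)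
  have "measure (Zp_haar p) B \<le> measure (Zp_haar p) (\<Union>r\<in>?R. Zp_cyl p n r)"
    using BZ by (intro finite_measure_mono sets.finite_UN finR cm) (auto simp: Zp_cyl_def)
  also have "\<dots> \<le> (\<Sum>r\<in>?R. measure (Zp_haar p) (Zp_cyl p n r))"
    using finR cm by (intro finite_measure_subadditive_finite) auto
  also have "\<dots> = (\<Sum>r\<in>?R. 1 / real p ^ n)"
    using R by (intro sum.cong refl measure_Zp_cyl[OF p]) auto
  also have "\<dots> \<le> real e / real p ^ n"
    using card by (simp add: divide_right_mono)
  finally show ?thesis .
qed

lemma measurable_Zp_coord:
  assumes X: "X \<in> measurable M (Zp_borel p)"
  shows "(\<lambda>w. (h :: int \<Rightarrow> int) (X w n)) \<in> measurable M borel"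
proof -
  have "h \<in> measurable borel borel"
    by (rule borel_measurable_continuous_onI) (simp add: continuous_on_discrete)
  from measurable_compose[OF measurable_compose[OF X measurable_component_Zp] this]
  show ?thesis .
qed

lemma sets_Zp_coord_pred:
  assumes p: "p > 0"
  shows "{y \<in> carrier (Zp p). Q (y n)} \<in> sets (Zp_haar p)"
proof -
  have "(\<lambda>y. y n) -` {r. Q r} \<inter> space (Zp_borel p) \<in> sets (Zp_borel p)"
    by (rule measurable_sets[OF measurable_component_Zp]) (rule borel_open, rule discrete_topology_class.open_discrete)
  moreover have "(\<lambda>y. y n) -` {r. Q r} \<inter> space (Zp_borel p) = {y \<in> carrier (Zp p). Q (y n)}"
    by auto
  ultimately show ?thesis by (simp add: sets_Zp_haar p)
qed

lemma Zp_poly_closed: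
  assumes p: "p > 0" and y: "y \<in> carrier (Zp p)"
  shows "Zp_poly p P y \<in> carrier (Zp p)"
proof -
  interpret cring "Zp p" by (rule Zp_cring[OF p])
  show ?thesis
    unfolding Zp_poly_def using y by (intro finsum_closed) (auto simp del: Zp_simps)
qed

lemma Zp_shift_closed:
  assumes p: "p > 0" and x: "x \<in> carrier (Zp p)" and y: "y \<in> carrier (Zp p)"
  shows "x \<ominus>\<^bsub>Zp p\<^esub> Zp_poly p P y \<in> carrier (Zp p)"
  unfolding Zp_minus[OF p x Zp_poly_closed[OF p y]]
  by (rule Zp_closed(3)[OF p x Zp_poly_closed[OF p y]])

lemma Zp_shift_eq:
  assumes p: "p > 0" and x: "x \<in> carrier (Zp p)" and y: "y \<in> carrier (Zp p)"
  shows "(x \<ominus>\<^bsub>Zp p\<^esub> Zp_poly p P y) n = (x n - poly P (y n)) mod int p ^ n"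
  by (subst Zp_minus[OF p x Zp_poly_closed[OF p y]]) (simp add: Zp_poly_eq[OF p y] mod_simps)

text \<open>
  With two varying points this covers both the slice \<open>y \<mapsto> x - P y\<close> and the joint measurability in
  \<open>(x, y)\<close> on which the measurability of the average depends.
\<close>

lemma measurable_Zp_shift:
  assumes p: "p > 0" and X: "X \<in> measurable M (Zp_borel p)" and Y: "Y \<in> measurable M (Zp_borel p)"
  shows "(\<lambda>w. X w \<ominus>\<^bsub>Zp p\<^esub> Zp_poly p P (Y w)) \<in> measurable M (Zp_borel p)"
proof (rule measurable_Zp_borelI)
  fix w assume "w \<in> space M"
  then show "X w \<ominus>\<^bsub>Zp p\<^esub> Zp_poly p P (Y w) \<in> carrier (Zp p)"
    using measurable_space[OF X] measurable_space[OF Y] by (simp add: Zp_shift_closed p)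
next
  fix n
  have "(\<lambda>w. X w n + (- poly P (Y w n))) \<in> measurable M borel"
    by (rule borel_measurable_add) (use measurable_Zp_coord[OF X, of "\<lambda>a. a"]
        measurable_Zp_coord[OF Y, of "\<lambda>a. - poly P a"] in auto)
  moreover have "(\<lambda>a. a mod int p ^ n) \<in> measurable borel borel"
    by (rule borel_measurable_continuous_onI) (simp add: continuous_on_discrete)
  ultimately have "(\<lambda>w. (X w n + (- poly P (Y w n))) mod int p ^ n) \<in> measurable M borel"
    by (rule measurable_compose)
  moreover have "(X w \<ominus>\<^bsub>Zp p\<^esub> Zp_poly p P (Y w)) n = (X w n + (- poly P (Y w n))) mod int p ^ n"
    if "w \<in> space M" for w
    using measurable_space[OF X that] measurable_space[OF Y that] by (simp add: Zp_shift_eq p)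
  ultimately show "(\<lambda>w. (X w \<ominus>\<^bsub>Zp p\<^esub> Zp_poly p P (Y w)) n) \<in> measurable M borel"
    by (simp cong: measurable_cong)
qed

lemma diff_dvd_poly_diff: "(x - y :: int) dvd poly P x - poly P y"
proof (induction P)
  case (pCons a P)
  have "poly (pCons a P) x - poly (pCons a P) y = x * (poly P x - poly P y) + (x - y) * poly P y"
    by (simp add: algebra_simps)
  then show ?case using pCons by simp
qed simp

lemma Zp_dvd_diff:
  assumes "y \<in> carrier (Zp p)" "n \<le> k" "n \<le> l"
  shows "int p ^ n dvd y k - y l"
  using Zp_mod_le[OF assms(1,2)] Zp_mod_le[OF assms(1,3)] unfolding mod_eq_dvd_iff[symmetric] by simp

lemma Zp_dvd_poly_level:
  assumes "y \<in> carrier (Zp p)" "n \<le> k" "n \<le> l"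
  shows "int p ^ n dvd poly Q (y k) \<longleftrightarrow> int p ^ n dvd poly Q (y l)"
proof -
  have "int p ^ n dvd poly Q (y k) - poly Q (y l)"
    using Zp_dvd_diff[OF assms] diff_dvd_poly_diff dvd_trans by blast
  then show ?thesis by (metis dvd_diff_right_iff dvd_diff_left_iff)
qed

section \<open>Sublevel sets and levels of the derivative\<close>

text \<open>
  Let \<open>L\<close> be least with \<open>p^m dvd p^(L d) a\<close>, where \<open>a\<close> is the coefficient of degree \<open>d\<close>.
  Minimality and interpolation leave at most \<open>d\<close> residues modulo \<open>p^L\<close> to the sublevel set, while
  the divisibility itself gives \<open>p^m \<le> p^(L d) |a|\<close>, that is, \<open>p^(-L)\<close> is at most
  \<open>|a|^(1/d) p^(-m/d)\<close>.
\<close>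

lemma measure_sublevel_le:
  fixes p :: nat and Q :: "int poly"
  assumes p: "prime p" and dQ: "degree Q \<le> d" and d: "d \<ge> 1" and A: "coeff Q d \<noteq> 0"
  shows "measure (Zp_haar p) {y \<in> carrier (Zp p). int p ^ m dvd poly Q (y m)}
    \<le> real d * real_of_int \<bar>coeff Q d\<bar> * real p powr (- (real m / real d))"
proof -
  have p0: "p > 0" using prime_gt_0_nat[OF p] .
  interpret prob_space "Zp_haar p" by (rule prob_space_Zp_haar[OF p0])
  let ?B = "{y \<in> carrier (Zp p). int p ^ m dvd poly Q (y m)}"
  let ?A = "coeff Q d"
  have B: "?B \<in> sets (Zp_haar p)" by (rule sets_Zp_coord_pred[OF p0])
  define L where "L = (LEAST l. int p ^ m dvd int p ^ (l * d) * ?A)"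
  have "int p ^ m dvd int p ^ (m * d) * ?A"
    using d by (intro dvd_mult2 le_imp_power_dvd) simp
  then have L: "int p ^ m dvd int p ^ (L * d) * ?A"
    unfolding L_def by (rule LeastI)
  have "int p ^ m dvd \<bar>int p ^ (L * d) * ?A\<bar>"
    using L by (simp only: dvd_abs_iff)
  then have "int p ^ m \<le> \<bar>int p ^ (L * d) * ?A\<bar>"
    by (rule zdvd_imp_le) (use A p0 in simp)
  then have "int p ^ m \<le> int p ^ (L * d) * \<bar>?A\<bar>"
    by (simp add: abs_mult)
  then have "real_of_int (int p ^ m) \<le> real_of_int (int p ^ (L * d) * \<bar>?A\<bar>)"
    by (simp only: of_int_le_iff)
  then have "real p ^ m \<le> real p ^ (L * d) * real_of_int \<bar>?A\<bar>" by simp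
  then have "real p powr real m \<le> real p powr (real L * real d) * real_of_int \<bar>?A\<bar>"
    using p0 by (simp add: powr_realpow[symmetric])
  then have "(real p powr real m) powr (1 / real d)
      \<le> (real p powr (real L * real d) * real_of_int \<bar>?A\<bar>) powr (1 / real d)"
    by (intro powr_mono2) auto
  also have "\<dots> = real p powr real L * real_of_int \<bar>?A\<bar> powr (1 / real d)"
    using d by (simp add: powr_mult powr_powr)
  also have "real_of_int \<bar>?A\<bar> powr (1 / real d) \<le> real_of_int \<bar>?A\<bar> powr 1"
    using d A by (intro powr_mono) auto
  finally have "real p powr (real m / real d) \<le> real p powr real L * real_of_int \<bar>?A\<bar>"
    using A by (simp add: powr_powr mult_left_mono)
  then have pL: "1 / real p ^ L \<le> real_of_int \<bar>?A\<bar> * real p powr (- (real m / real d))"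
    using p0 by (simp add: powr_minus field_simps powr_realpow)
  have "measure (Zp_haar p) ?B \<le> real d / real p ^ L"
  proof (cases L)
    case 0
    have "measure (Zp_haar p) ?B \<le> 1" by simp
    also have "1 \<le> real d / real p ^ L" using 0 d by simp
    finally show ?thesis .
  next
    case (Suc l)
    have nd: "\<not> int p ^ m dvd int p ^ (l * d) * ?A"
      using not_less_Least[of l "\<lambda>l. int p ^ m dvd int p ^ (l * d) * ?A"] Suc by (simp add: L_def)
    define N where "N = max m L"
    have "card ((\<lambda>y. y mod int p ^ Suc l) ` (\<lambda>y. y N) ` ?B) \<le> d"
    proof (rule card_residues_le[OF p dQ _ nd])
      fix z assume "z \<in> (\<lambda>y. y N) ` ?B"
      then show "int p ^ m dvd poly Q z"
        using Zp_dvd_poly_level[of _ p m m N Q] by (auto simp: N_def)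
    qed
    also have "(\<lambda>y. y mod int p ^ Suc l) ` (\<lambda>y. y N) ` ?B = (\<lambda>y. y L) ` ?B"
      unfolding image_image Suc[symmetric]
      by (intro image_cong refl) (auto simp: N_def intro!: Zp_mod_le)
    finally show ?thesis by (rule measure_le_card_residues[OF p0 B])
  qed
  also have "\<dots> = real d * (1 / real p ^ L)" by simp
  also have "\<dots> \<le> real d * (real_of_int \<bar>?A\<bar> * real p powr (- (real m / real d)))"
    by (intro mult_left_mono pL) simp
  finally show ?thesis by (simp add: mult.assoc)
qed

text \<open>
  The points at which the derivative has valuation exactly \<open>m\<close>. The residue modulo \<open>p^(m+1)\<close> decides
  this, so one coordinate suffices.
\<close>

definition crit_level :: "nat \<Rightarrow> int poly \<Rightarrow> nat \<Rightarrow> (nat \<Rightarrow> int) set" where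
  "crit_level p P m = {y \<in> carrier (Zp p). int p ^ m dvd poly (pderiv P) (y (Suc m)) \<and>
     \<not> int p ^ Suc m dvd poly (pderiv P) (y (Suc m))}"

lemma crit_level_sets: "p > 0 \<Longrightarrow> crit_level p P m \<in> sets (Zp_haar p)"
  unfolding crit_level_def by (rule sets_Zp_coord_pred)

lemma measure_crit_level_le:
  assumes p: "prime p" and d: "degree P \<ge> 1"
  shows "measure (Zp_haar p) (crit_level p P m)
    \<le> real (degree P ^ 2) * real_of_int \<bar>lead_coeff P\<bar> * real p powr (- (real m / real (degree P)))"
    and "measure (Zp_haar p) {y \<in> carrier (Zp p). int p ^ m dvd poly (pderiv P) (y m)}
    \<le> real (degree P ^ 2) * real_of_int \<bar>lead_coeff P\<bar> * real p powr (- (real m / real (degree P)))"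
proof -
  have p0: "p > 0" using prime_gt_0_nat[OF p] .
  interpret prob_space "Zp_haar p" by (rule prob_space_Zp_haar[OF p0])
  \<comment> \<open>\<open>X P'\<close> instead of \<open>P'\<close>: its sublevel sets are larger and its degree \<open>d\<close> is positive even when
    \<open>P'\<close> is constant, so linear \<open>P\<close> needs no separate treatment.\<close>
  define Q where "Q = pCons 0 (pderiv P)"
  have Q: "degree Q \<le> degree P"
    using d by (simp add: Q_def degree_pderiv degree_pCons_eq_if)
  have cQ: "coeff Q (degree P) = int (degree P) * lead_coeff P"
    using d by (cases "degree P") (simp_all add: Q_def coeff_pderiv)
  have nz: "coeff Q (degree P) \<noteq> 0" using d unfolding cQ by auto
  have "measure (Zp_haar p) {y \<in> carrier (Zp p). int p ^ m dvd poly (pderiv P) (y m)}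
     \<le> measure (Zp_haar p) {y \<in> carrier (Zp p). int p ^ m dvd poly Q (y m)}"
    by (intro finite_measure_mono sets_Zp_coord_pred[OF p0]) (auto simp: Q_def)
  also note measure_sublevel_le[OF p Q d nz, of m]
  finally show *: "measure (Zp_haar p) {y \<in> carrier (Zp p). int p ^ m dvd poly (pderiv P) (y m)}
    \<le> real (degree P ^ 2) * real_of_int \<bar>lead_coeff P\<bar> * real p powr (- (real m / real (degree P)))"
    unfolding cQ by (simp add: abs_mult power2_eq_square mult_ac)
  have "measure (Zp_haar p) (crit_level p P m) \<le>
    measure (Zp_haar p) {y \<in> carrier (Zp p). int p ^ m dvd poly (pderiv P) (y m)}"
    using Zp_dvd_poly_level[of _ p m "Suc m" m "pderiv P"]
    by (intro finite_measure_mono sets_Zp_coord_pred[OF p0]) (auto simp: crit_level_def)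
  also note *
  finally show "measure (Zp_haar p) (crit_level p P m)
    \<le> real (degree P ^ 2) * real_of_int \<bar>lead_coeff P\<bar> * real p powr (- (real m / real (degree P)))" .
qed

text \<open>
  The exceptional points are the zeros of the derivative, which lie in all of its sublevel sets.
\<close>

lemma AE_crit_level:
  assumes p: "prime p" and d: "degree P \<ge> 1"
  shows "AE y in Zp_haar p. \<exists>m. y \<in> crit_level p P m"
proof -
  have p0: "p > 0" and p1: "p > 1" using prime_gt_0_nat[OF p] prime_gt_1_nat[OF p] by simp_all
  interpret prob_space "Zp_haar p" by (rule prob_space_Zp_haar[OF p0])
  let ?S = "\<lambda>m. {y \<in> carrier (Zp p). int p ^ m dvd poly (pderiv P) (y m)}"
  let ?c = "real (degree P ^ 2) * real_of_int \<bar>lead_coeff P\<bar>"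
  have S [measurable]: "?S m \<in> sets (Zp_haar p)" for m by (rule sets_Zp_coord_pred[OF p0])
  have le: "measure (Zp_haar p) (\<Inter>m. ?S m) \<le> ?c * (real p powr (- (1 / real (degree P)))) ^ m" for m
  proof -
    have "measure (Zp_haar p) (\<Inter>m. ?S m) \<le> measure (Zp_haar p) (?S m)"
      by (intro finite_measure_mono S) blast
    also note measure_crit_level_le(2)[OF p d, of m]
    also have "real p powr (- (real m / real (degree P))) = (real p powr (- (1 / real (degree P)))) ^ m"
      using p0 by (simp add: powr_powr[symmetric] powr_realpow[symmetric]) (simp add: powr_powr)
    finally show ?thesis .
  qed
  have "real p powr (- (1 / real (degree P))) < 1"
    using p1 d by (simp add: powr_less_one)
  then have "(\<lambda>m. ?c * (real p powr (- (1 / real (degree P)))) ^ m) \<longlonglongrightarrow> ?c * 0"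
    by (intro tendsto_intros LIMSEQ_power_zero) simp
  then have "measure (Zp_haar p) (\<Inter>m. ?S m) \<le> 0"
    using le by (intro LIMSEQ_le_const) auto
  then have "measure (Zp_haar p) (\<Inter>m. ?S m) = 0"
    by (intro antisym measure_nonneg) simp_all
  then have "(\<Inter>m. ?S m) \<in> null_sets (Zp_haar p)"
    by (intro null_setsI) (auto simp: emeasure_eq_measure)
  then have "AE y in Zp_haar p. y \<notin> (\<Inter>m. ?S m)"
    by (rule AE_not_in)
  then show ?thesis
  proof (rule AE_mp, intro AE_I2 impI)
    fix y assume y: "y \<in> space (Zp_haar p)" "y \<notin> (\<Inter>m. ?S m)"
    then have yZ: "y \<in> carrier (Zp p)" by (simp add: space_Zp_haar p0)
    let ?m = "LEAST m. y \<notin> ?S m"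
    from y obtain m0 where "y \<notin> ?S m0" by blast
    then have m: "y \<notin> ?S ?m" by (rule LeastI)
    obtain m where Sm: "?m = Suc m" using m yZ by (cases ?m) auto
    have "y \<in> ?S m" using not_less_Least[of m "\<lambda>m. y \<notin> ?S m"] Sm by auto
    then have "y \<in> crit_level p P m"
      using m Zp_dvd_poly_level[of y p m m "Suc m" "pderiv P"] yZ
      unfolding Sm by (auto simp: crit_level_def)
    then show "\<exists>m. y \<in> crit_level p P m" ..
  qed
qed

section \<open>Bounded density on a level of the derivative\<close>

text \<open>
  Points of \<open>E m\<close> with nearly the same value of \<open>P\<close> are counted in two scales. Interpolation allows at
  most \<open>d\<close> residues modulo \<open>p^(m+1)\<close>, once \<open>n\<close> is too large for \<open>p^n\<close> to divide \<open>p^(m d)\<close> times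
  the leading coefficient. Within one such residue class Hensel's lemma fixes the residue modulo
  \<open>p^(n-m)\<close>. So at most \<open>d\<close> balls of measure \<open>p^(m-n)\<close> remain.
\<close>

lemma measure_crit_level_fibre_le:
  assumes p: "prime p" and d: "degree P \<ge> 1" and x: "x \<in> carrier (Zp p)"
    and n: "m * degree P + nat \<bar>lead_coeff P\<bar> + 2 * m + 1 \<le> n"
  shows "measure (Zp_haar p) {y \<in> crit_level p P m. (x \<ominus>\<^bsub>Zp p\<^esub> Zp_poly p P y) n = r}
    \<le> real (degree P) * real p ^ m * (1 / real p ^ n)"
proof -
  have p0: "p > 0" and p1: "p > 1" using prime_gt_0_nat[OF p] prime_gt_1_nat[OF p] by simp_all
  let ?d = "degree P" and ?a = "lead_coeff P"
  let ?B = "{y \<in> crit_level p P m. (x \<ominus>\<^bsub>Zp p\<^esub> Zp_poly p P y) n = r}"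
  define Q where "Q = P - [:x n - r:]"
  define T where "T = (\<lambda>y. y n) ` ?B"
  have BZ: "?B \<subseteq> carrier (Zp p)" by (auto simp: crit_level_def)
  have B: "?B \<in> sets (Zp_haar p)"
  proof -
    have "?B = crit_level p P m \<inter> {y \<in> carrier (Zp p). (x n - poly P (y n)) mod int p ^ n = r}"
      by (auto simp: Zp_shift_eq[OF p0 x] crit_level_def)
    also have "\<dots> \<in> sets (Zp_haar p)"
      by (intro sets.Int crit_level_sets[OF p0] sets_Zp_coord_pred[OF p0])
    finally show ?thesis .
  qed
  have T: "int p ^ n dvd poly Q z" "\<not> int p ^ Suc m dvd poly (pderiv P) z" if "z \<in> T" for z
  proof -
    from that obtain y where y: "y \<in> ?B" and z: "z = y n" unfolding T_def by blast
    have yZ: "y \<in> carrier (Zp p)" using y BZ by blast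
    have "(x n - poly P (y n)) mod int p ^ n = r"
      using y Zp_shift_eq[OF p0 x yZ, of P n] by simp
    then have "int p ^ n dvd (x n - poly P (y n)) - r"
      by (metis dvd_minus_mod)
    also have "(x n - poly P (y n)) - r = - poly Q (y n)" by (simp add: Q_def)
    finally show "int p ^ n dvd poly Q z" by (simp add: z)
    show "\<not> int p ^ Suc m dvd poly (pderiv P) z"
      using y n Zp_dvd_poly_level[OF yZ, of "Suc m" "Suc m" n "pderiv P"]
      unfolding z by (simp add: crit_level_def)
  qed
  have dQ: "degree Q \<le> ?d" and cQ: "coeff Q ?d = ?a"
    using d by (auto simp: Q_def intro!: degree_diff_le split: nat.splits simp: coeff_pCons)
  have nd: "\<not> int p ^ n dvd int p ^ (m * ?d) * coeff Q ?d"
  proof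
    assume "int p ^ n dvd int p ^ (m * ?d) * coeff Q ?d"
    moreover have "int p ^ (m * ?d) * int p ^ nat \<bar>?a\<bar> dvd int p ^ n"
      using n by (simp add: power_add[symmetric] le_imp_power_dvd)
    ultimately have "int p ^ (m * ?d) * int p ^ nat \<bar>?a\<bar> dvd int p ^ (m * ?d) * ?a"
      unfolding cQ by (rule dvd_trans[rotated])
    then have "int p ^ nat \<bar>?a\<bar> dvd ?a" using p0 by simp
    moreover have "?a \<noteq> 0" using d by auto
    ultimately have "\<bar>int p ^ nat \<bar>?a\<bar>\<bar> \<le> \<bar>?a\<bar>" by (rule dvd_imp_le_int[rotated])
    then have "int (p ^ nat \<bar>?a\<bar>) \<le> int (nat \<bar>?a\<bar>)" by simp
    then have "p ^ nat \<bar>?a\<bar> \<le> nat \<bar>?a\<bar>" by (simp only: of_nat_le_iff)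
    moreover have "nat \<bar>?a\<bar> < p ^ nat \<bar>?a\<bar>" using p1 by (intro power_gt_expt) simp
    ultimately show False by (meson leD)
  qed
  have c1: "card ((\<lambda>z. z mod int p ^ Suc m) ` T) \<le> ?d"
    by (rule card_residues_le[OF p dQ T(1) nd])
  have mod: "z mod int p ^ (n - m) mod int p ^ Suc m = z mod int p ^ Suc m" for z :: int
    using n by (intro mod_mod_cancel le_imp_power_dvd) simp
  have "card ((\<lambda>z. z mod int p ^ (n - m)) ` T) \<le> card ((\<lambda>z. z mod int p ^ Suc m) ` T)"
  proof (rule card_inj_on_le[where f = "\<lambda>z. z mod int p ^ Suc m"])
    show "inj_on (\<lambda>z. z mod int p ^ Suc m) ((\<lambda>z. z mod int p ^ (n - m)) ` T)"
    proof (rule inj_onI, clarify)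
      fix y z assume yz: "y \<in> T" "z \<in> T"
        "y mod int p ^ (n - m) mod int p ^ Suc m = z mod int p ^ (n - m) mod int p ^ Suc m"
      then have "int p ^ Suc m dvd y - z"
        unfolding mod by (simp add: mod_eq_dvd_iff)
      moreover have "int p ^ n dvd poly P y - poly P z"
        using dvd_diff[OF T(1)[OF yz(1)] T(1)[OF yz(2)]] by (simp add: Q_def)
      ultimately have "int p ^ (n - m) dvd y - z"
        using n T(2)[OF yz(2)] by (intro Hensel_separation[OF p]) auto
      then show "y mod int p ^ (n - m) = z mod int p ^ (n - m)"
        by (simp add: mod_eq_dvd_iff)
    qed
    show "(\<lambda>z. z mod int p ^ Suc m) ` (\<lambda>z. z mod int p ^ (n - m)) ` T \<subseteq> (\<lambda>z. z mod int p ^ Suc m) ` T"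
      unfolding image_image mod by simp
    have "(\<lambda>z. z mod int p ^ Suc m) ` T \<subseteq> {0..<int p ^ Suc m}"
      using p0 by auto
    then show "finite ((\<lambda>z. z mod int p ^ Suc m) ` T)" by (rule finite_subset) simp
  qed
  also have "(\<lambda>z. z mod int p ^ (n - m)) ` T = (\<lambda>y. y (n - m)) ` ?B"
    unfolding T_def image_image by (intro image_cong refl Zp_mod_le) (use BZ in auto)
  finally have "measure (Zp_haar p) ?B \<le> real ?d / real p ^ (n - m)"
    using c1 by (intro measure_le_card_residues[OF p0 B]) simp
  also have "\<dots> = real ?d * real p ^ m * (1 / real p ^ n)"
    using p0 n by (simp add: power_diff)
  finally show ?thesis .
qed

text \<open>
  The algebra of finite unions of balls, written as unions of balls of one radius that is at most
  \<open>p^(-n0)\<close>. It does not depend on \<open>n0\<close>, since a set decided modulo \<open>p^n\<close> is also decided modulo every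
  higher power; so it suffices to compare measures on small balls.
\<close>

definition Zp_level_sets :: "nat \<Rightarrow> nat \<Rightarrow> (nat \<Rightarrow> int) set set" where
  "Zp_level_sets p n0 = {{x \<in> carrier (Zp p). x n \<in> R} | n R. n0 \<le> n}"

lemma algebra_Zp_level_sets: "algebra (carrier (Zp p)) (Zp_level_sets p n0)"
proof (unfold algebra_iff_Un, intro conjI ballI)
  show "Zp_level_sets p n0 \<subseteq> Pow (carrier (Zp p))" by (auto simp: Zp_level_sets_def)
  show "{} \<in> Zp_level_sets p n0"
    unfolding Zp_level_sets_def by (intro CollectI exI[of _ n0] exI[of _ "{}"]) simp
next
  fix a assume "a \<in> Zp_level_sets p n0"
  then obtain n R where "n0 \<le> n" "a = {x \<in> carrier (Zp p). x n \<in> R}"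
    by (auto simp: Zp_level_sets_def)
  then show "carrier (Zp p) - a \<in> Zp_level_sets p n0"
    unfolding Zp_level_sets_def by (intro CollectI exI[of _ n] exI[of _ "- R"]) auto
next
  fix a b assume "a \<in> Zp_level_sets p n0" "b \<in> Zp_level_sets p n0"
  then obtain n R n' R' where a: "n0 \<le> n" "a = {x \<in> carrier (Zp p). x n \<in> R}"
    and b: "n0 \<le> n'" "b = {x \<in> carrier (Zp p). x n' \<in> R'}"
    by (auto simp: Zp_level_sets_def)
  define N where "N = max n n'"
  have "x N mod int p ^ n = x n" "x N mod int p ^ n' = x n'" if "x \<in> carrier (Zp p)" for x
    using that by (auto simp: N_def intro!: Zp_mod_le)
  then have "a \<union> b = {x \<in> carrier (Zp p). x N \<in> {r. r mod int p ^ n \<in> R \<or> r mod int p ^ n' \<in> R'}}"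
    unfolding a b by auto
  moreover have "n0 \<le> N" using a by (simp add: N_def)
  ultimately show "a \<union> b \<in> Zp_level_sets p n0"
    unfolding Zp_level_sets_def by (intro CollectI exI conjI)
qed

lemma sigma_sets_Zp_level_sets:
  assumes p: "p > 0"
  shows "sigma_sets (carrier (Zp p)) (Zp_level_sets p n0) = sets (Zp_borel p)"
proof
  have "{x \<in> carrier (Zp p). x n \<in> R} \<in> sets (Zp_borel p)" for n R
    using sets_Zp_coord_pred[OF p, of "\<lambda>r. r \<in> R" n] by (simp add: sets_Zp_haar p)
  then have "Zp_level_sets p n0 \<subseteq> sets (Zp_borel p)"
    by (auto simp: Zp_level_sets_def)
  from sets.sigma_sets_subset[OF this]
  show "sigma_sets (carrier (Zp p)) (Zp_level_sets p n0) \<subseteq> sets (Zp_borel p)" by simp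
next
  have "Zp_cyl p n r \<in> Zp_level_sets p n0" for n r
  proof -
    have "Zp_cyl p n r = {x \<in> carrier (Zp p). x (max n0 n) \<in> {s. s mod int p ^ n = r}}"
      using Zp_mod_le[of _ p n "max n0 n"] by (auto simp: Zp_cyl_def)
    then show ?thesis
      unfolding Zp_level_sets_def by (intro CollectI exI conjI) (assumption, simp)
  qed
  moreover have "{} \<in> Zp_level_sets p n0"
    using algebra_Zp_level_sets by (simp add: algebra_iff_Un)
  ultimately show "sets (Zp_borel p) \<subseteq> sigma_sets (carrier (Zp p)) (Zp_level_sets p n0)"
    unfolding sets_Zp_borel by (intro sigma_sets_mono') auto
qed

lemma measure_le_if_le_on_cylinders:
  assumes p: "p > 0" and M: "finite_measure M" and N: "finite_measure N"
    and sM: "sets M = sets (Zp_borel p)" and sN: "sets N = sets (Zp_borel p)"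
    and le: "\<And>n r. n0 \<le> n \<Longrightarrow> r \<in> {0..<int p ^ n} \<Longrightarrow>
      measure M (Zp_cyl p n r) \<le> c * measure N (Zp_cyl p n r)"
    and c: "c \<ge> 0" and B: "B \<in> sets M"
  shows "measure M B \<le> c * measure N B"
proof (rule measure_le_if_le_on_generating_algebra[OF M N algebra_Zp_level_sets[of p n0] _ _ _ c B])
  show "sets M = sigma_sets (carrier (Zp p)) (Zp_level_sets p n0)"
    "sets N = sigma_sets (carrier (Zp p)) (Zp_level_sets p n0)"
    by (simp_all add: sM sN sigma_sets_Zp_level_sets p)
next
  fix a assume "a \<in> Zp_level_sets p n0"
  then obtain n R where n: "n0 \<le> n" and a: "a = {x \<in> carrier (Zp p). x n \<in> R}"
    by (auto simp: Zp_level_sets_def)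
  define R' where "R' = R \<inter> {0..<int p ^ n}"
  have a: "a = (\<Union>r\<in>R'. Zp_cyl p n r)"
    unfolding a R'_def by (auto simp: Zp_cyl_def Zp_carrier_iff)
  have fin: "finite R'" unfolding R'_def by simp
  have dis: "disjoint_family_on (Zp_cyl p n) R'"
    by (auto simp: disjoint_family_on_def Zp_cyl_def)
  have "measure M a = (\<Sum>r\<in>R'. measure M (Zp_cyl p n r))"
    unfolding a using fin dis Zp_cyl_sets
    by (intro finite_measure.finite_measure_finite_Union[OF M]) (auto simp: sM)
  also have "\<dots> \<le> (\<Sum>r\<in>R'. c * measure N (Zp_cyl p n r))"
    using n by (intro sum_mono le) (auto simp: R'_def)
  also have "\<dots> = c * (\<Sum>r\<in>R'. measure N (Zp_cyl p n r))" by (simp add: sum_distrib_left)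
  also have "(\<Sum>r\<in>R'. measure N (Zp_cyl p n r)) = measure N a"
    unfolding a using fin dis Zp_cyl_sets
    by (intro finite_measure.finite_measure_finite_Union[OF N, symmetric]) (auto simp: sN)
  finally show "measure M a \<le> c * measure N a" .
qed

text \<open>
  The change of variables: the image of Haar measure on \<open>E m\<close> is dominated by \<open>d p^m\<close> times Haar
  measure on small balls by the previous count, hence on all measurable sets.
\<close>

lemma nn_integral_crit_level_le:
  assumes p: "prime p" and d: "degree P \<ge> 1" and x: "x \<in> carrier (Zp p)"
    and g: "g \<in> borel_measurable (Zp_haar p)"
  shows "(\<integral>\<^sup>+y. g (x \<ominus>\<^bsub>Zp p\<^esub> Zp_poly p P y) * indicator (crit_level p P m) y \<partial>Zp_haar p)
    \<le> ennreal (real (degree P) * real p ^ m) * (\<integral>\<^sup>+y. g y \<partial>Zp_haar p)"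
proof -
  have p0: "p > 0" using prime_gt_0_nat[OF p] .
  interpret prob_space "Zp_haar p" by (rule prob_space_Zp_haar[OF p0])
  note s = sets_Zp_haar[OF p0]
  let ?\<nu> = "Zp_haar p" and ?E = "crit_level p P m"
  define t where "t = (\<lambda>y. x \<ominus>\<^bsub>Zp p\<^esub> Zp_poly p P y)"
  define c where "c = real (degree P) * real p ^ m"
  have E [measurable]: "?E \<in> sets ?\<nu>" by (rule crit_level_sets[OF p0])
  have "(\<lambda>y. y) \<in> measurable ?\<nu> (Zp_borel p)"
    by (rule measurable_ident_sets[OF s])
  then have "t \<in> measurable ?\<nu> (Zp_borel p)"
    unfolding t_def using x by (intro measurable_Zp_shift[OF p0]) auto
  then have t [measurable]: "t \<in> measurable ?\<nu> ?\<nu>"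
    by (simp add: measurable_cong_sets[OF refl s])
  define M0 where "M0 = density ?\<nu> (indicator ?E)"
  define M where "M = distr M0 ?\<nu> t"
  have tM0: "t \<in> measurable M0 ?\<nu>" unfolding M0_def using t by simp
  have em: "emeasure M B = emeasure ?\<nu> (?E \<inter> (t -` B \<inter> space ?\<nu>))" if "B \<in> sets ?\<nu>" for B
  proof -
    have "emeasure M B = emeasure M0 (t -` B \<inter> space M0)"
      unfolding M_def by (rule emeasure_distr[OF tM0 that])
    then show ?thesis
      using emeasure_restricted[OF E measurable_sets[OF t that]] by (simp add: M0_def)
  qed
  have finM: "finite_measure M"
    by (rule finite_measureI) (use em[of "space ?\<nu>"] in \<open>simp add: M_def emeasure_eq_measure\<close>)
  have mM: "measure M B = measure ?\<nu> (?E \<inter> (t -` B \<inter> space ?\<nu>))" if "B \<in> sets ?\<nu>" for B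
    using em[OF that] by (simp add: measure_def)
  have le: "measure M B \<le> c * measure ?\<nu> B" if "B \<in> sets M" for B
  proof (rule measure_le_if_le_on_cylinders[OF p0 finM _ _ s _ _ that])
    show "finite_measure ?\<nu>" by unfold_locales
    show "sets M = sets (Zp_borel p)" by (simp add: M_def s)
    show "c \<ge> 0" by (simp add: c_def)
    fix n r assume n: "m * degree P + nat \<bar>lead_coeff P\<bar> + 2 * m + 1 \<le> n"
      and r: "r \<in> {0..<int p ^ n}"
    have "?E \<inter> (t -` Zp_cyl p n r \<inter> space ?\<nu>) = {y \<in> ?E. t y n = r}"
      unfolding t_def using Zp_shift_closed[OF p0 x]
      by (auto simp: Zp_cyl_def space_Zp_haar p0 crit_level_def)
    then show "measure M (Zp_cyl p n r) \<le> c * measure ?\<nu> (Zp_cyl p n r)"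
      using measure_crit_level_fibre_le[OF p d x n, of r]
      by (subst mM) (simp_all add: s Zp_cyl_sets measure_Zp_cyl[OF p0 r] c_def t_def)
  qed
  have "M \<le> scale_measure (ennreal c) ?\<nu>"
  proof (rule le_measure_iff[THEN iffD2])
    have "emeasure M B \<le> ennreal c * emeasure ?\<nu> B" for B
    proof (cases "B \<in> sets M")
      case True
      have "ennreal (measure M B) \<le> ennreal (c * measure ?\<nu> B)"
        by (rule ennreal_leI[OF le[OF True]])
      then show ?thesis
        by (simp add: c_def ennreal_mult emeasure_eq_measure finite_measure.emeasure_eq_measure[OF finM])
    qed (simp add: emeasure_notin_sets)
    then show "if space M = space (scale_measure (ennreal c) ?\<nu>)
      then if sets M = sets (scale_measure (ennreal c) ?\<nu>)
        then emeasure M \<le> emeasure (scale_measure (ennreal c) ?\<nu>)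
        else sets M \<subseteq> sets (scale_measure (ennreal c) ?\<nu>)
      else space M \<subseteq> space (scale_measure (ennreal c) ?\<nu>)"
      by (simp add: M_def le_fun_def space_scale_measure)
  qed
  then have "(\<integral>\<^sup>+y. g y \<partial>M) \<le> (\<integral>\<^sup>+y. g y \<partial>scale_measure (ennreal c) ?\<nu>)"
    by (rule nn_integral_mono_measure[rotated]) (simp add: M_def)
  also have "\<dots> = ennreal c * (\<integral>\<^sup>+y. g y \<partial>?\<nu>)"
    using g by (rule nn_integral_scale_measure)
  also have "(\<integral>\<^sup>+y. g y \<partial>M) = (\<integral>\<^sup>+y. indicator ?E y * g (t y) \<partial>?\<nu>)"
  proof -
    have "(\<integral>\<^sup>+y. g y \<partial>M) = (\<integral>\<^sup>+y. g (t y) \<partial>M0)"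
      unfolding M_def by (rule nn_integral_distr[OF tM0]) (use g in simp)
    also have "\<dots> = (\<integral>\<^sup>+y. indicator ?E y * g (t y) \<partial>?\<nu>)"
      unfolding M0_def by (rule nn_integral_density) (use measurable_compose[OF t g] in auto)
    finally show ?thesis .
  qed
  finally show ?thesis unfolding t_def c_def by (simp add: mult.commute)
qed

section \<open>One polynomial\<close>

lemma le_threshold_plus_power:
  fixes a t s :: real
  assumes "a \<ge> 0" "t > 0" "s \<ge> 1"
  shows "a \<le> t + t powr (1 - s) * a powr s"
proof (cases "a \<le> t")
  case True
  then show ?thesis by (simp add: add_increasing2)
next
  case False
  then have a: "t < a" "a > 0" using assms by auto
  have "a = a powr (1 - s) * a powr s"
    using a by (simp add: powr_add[symmetric])
  also have "\<dots> \<le> t powr (1 - s) * a powr s"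
    using a assms by (intro mult_right_mono powr_mono2') auto
  finally show ?thesis using assms by simp
qed

text \<open>
  On each level of the derivative the smallness of the level pays for the part of \<open>g\<close> below the
  threshold, and the density bound for the part above it, where \<open>g\<close> is controlled by \<open>g^s\<close>.
\<close>

lemma pushforward_bound:
  fixes P :: "int poly" and s :: real
  assumes d: "degree P \<ge> 1" and s: "s > real (degree P) + 1"
  shows "\<exists>C\<ge>0. \<forall>p x g. prime p \<longrightarrow> x \<in> carrier (Zp p) \<longrightarrow> g \<in> borel_measurable (Zp_haar p) \<longrightarrow>
    (\<forall>z. 0 \<le> g z) \<longrightarrow> (\<integral>\<^sup>+z. ennreal (g z powr s) \<partial>Zp_haar p) \<le> 1 \<longrightarrow>
    (\<integral>\<^sup>+y. ennreal (g (x \<ominus>\<^bsub>Zp p\<^esub> Zp_poly p P y)) \<partial>Zp_haar p) \<le> ennreal C"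
proof -
  let ?d = "real (degree P)"
  have s1: "s > 1" using s by linarith
  have "1 / (s - 1) < 1 / ?d"
    using d s by (intro divide_strict_left_mono) auto
  then obtain c where c: "1 / (s - 1) < c" "c < 1 / ?d" using dense by blast
  \<comment> \<open>The smaller of the two rates of decay in \<open>m\<close>: below the threshold \<open>p^(c m)\<close> and above it.\<close>
  define \<delta> where "\<delta> = min (1 / ?d - c) (c * (s - 1) - 1)"
  have \<delta>: "\<delta> > 0" using c s1 by (simp add: \<delta>_def field_simps)
  define A where "A = real (degree P ^ 2) * real_of_int \<bar>lead_coeff P\<bar>"
  define C where "C = (A + ?d) / (1 - 2 powr (- \<delta>))"
  have A0: "A \<ge> 0" by (simp add: A_def)
  have q1: "2 powr (- \<delta>) < 1" using \<delta> by (simp add: powr_less_one)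
  have C0: "C \<ge> 0" using A0 q1 by (simp add: C_def)
  have sums: "(\<lambda>m. (A + ?d) * (2 powr (- \<delta>)) ^ m) sums C"
    using geometric_sums[of "2 powr (- \<delta>)"] q1 sums_mult[of _ _ "A + ?d"] unfolding C_def by fastforce
  show ?thesis
  proof (intro exI[of _ C] conjI C0 allI impI)
    fix p x and g :: "(nat \<Rightarrow> int) \<Rightarrow> real"
    assume p: "prime p" and x: "x \<in> carrier (Zp p)" and g: "g \<in> borel_measurable (Zp_haar p)"
      and g0: "\<forall>z. 0 \<le> g z" and I: "(\<integral>\<^sup>+z. ennreal (g z powr s) \<partial>Zp_haar p) \<le> 1"
    have p0: "p > 0" and p2: "real p \<ge> 2" using prime_gt_0_nat[OF p] prime_ge_2_nat[OF p] by auto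
    let ?\<nu> = "Zp_haar p" and ?E = "crit_level p P"
    interpret prob_space ?\<nu> by (rule prob_space_Zp_haar[OF p0])
    define T where "T = (\<lambda>y. x \<ominus>\<^bsub>Zp p\<^esub> Zp_poly p P y)"
    define t where "t = (\<lambda>m. real p powr (c * real m))"
    have t0: "t m > 0" for m using p0 by (simp add: t_def)
    have E [measurable]: "?E m \<in> sets ?\<nu>" for m by (rule crit_level_sets[OF p0])
    have T [measurable]: "T \<in> measurable ?\<nu> ?\<nu>"
      unfolding T_def measurable_cong_sets[OF refl sets_Zp_haar[OF p0]]
      by (rule measurable_Zp_shift[OF p0]) (use x measurable_ident_sets[OF sets_Zp_haar[OF p0]] in auto)
    have gs: "(\<lambda>z. ennreal (g z powr s)) \<in> borel_measurable ?\<nu>" using g by measurable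
    have small: "real p powr (- (\<epsilon> * real m)) \<le> (2 powr (- \<delta>)) ^ m" if "\<delta> \<le> \<epsilon>" for \<epsilon> m
    proof -
      have "real p powr (- (\<epsilon> * real m)) \<le> 2 powr (- (\<epsilon> * real m))"
        using p2 \<delta> that by (intro powr_mono2') auto
      also have "\<dots> \<le> 2 powr (- (\<delta> * real m))"
        using that by (intro powr_mono) (auto simp: mult_right_mono)
      also have "\<dots> = (2 powr (- \<delta>)) ^ m"
        by (simp add: powr_powr flip: powr_realpow)
      finally show ?thesis .
    qed
    have level: "(\<integral>\<^sup>+y. ennreal (g (T y)) * indicator (?E m) y \<partial>?\<nu>)
        \<le> ennreal ((A + ?d) * (2 powr (- \<delta>)) ^ m)" for m
    proof -
      have pw: "ennreal (g (T y)) \<le> ennreal (t m) + ennreal (t m powr (1 - s)) * ennreal (g (T y) powr s)" for y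
        using le_threshold_plus_power[of "g (T y)" "t m" s] g0 t0[of m] s1
        by (simp flip: ennreal_mult ennreal_plus add: ennreal_leI)
      have "(\<integral>\<^sup>+y. ennreal (g (T y)) * indicator (?E m) y \<partial>?\<nu>)
        \<le> (\<integral>\<^sup>+y. ennreal (t m) * indicator (?E m) y
              + ennreal (t m powr (1 - s)) * (ennreal (g (T y) powr s) * indicator (?E m) y) \<partial>?\<nu>)"
      proof (rule nn_integral_mono)
        fix y
        show "ennreal (g (T y)) * indicator (?E m) y \<le> ennreal (t m) * indicator (?E m) y
              + ennreal (t m powr (1 - s)) * (ennreal (g (T y) powr s) * indicator (?E m) y)"
          using pw[of y] by (auto simp: indicator_def)
      qed
      also have "\<dots> = ennreal (t m) * emeasure ?\<nu> (?E m)
          + ennreal (t m powr (1 - s)) * (\<integral>\<^sup>+y. ennreal (g (T y) powr s) * indicator (?E m) y \<partial>?\<nu>)"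
        using g by (subst nn_integral_add) (auto simp: nn_integral_cmult nn_integral_cmult_indicator)
      also have "\<dots> \<le> ennreal (t m) * ennreal (A * real p powr (- (real m / ?d)))
          + ennreal (t m powr (1 - s)) * (ennreal (?d * real p ^ m) * 1)"
      proof (intro add_mono mult_left_mono)
        show "emeasure ?\<nu> (?E m) \<le> ennreal (A * real p powr (- (real m / ?d)))"
          unfolding emeasure_eq_measure A_def by (intro ennreal_leI measure_crit_level_le(1)[OF p d])
        show "(\<integral>\<^sup>+y. ennreal (g (T y) powr s) * indicator (?E m) y \<partial>?\<nu>) \<le> ennreal (?d * real p ^ m) * 1"
          using nn_integral_crit_level_le[OF p d x gs, of m] mult_left_mono[OF I, of "ennreal (?d * real p ^ m)"]
          unfolding T_def by (auto intro: order_trans)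
      qed auto
      also have "\<dots> = ennreal (A * (t m * real p powr (- (real m / ?d))) + ?d * (t m powr (1 - s) * real p ^ m))"
        using A0 t0[of m] by (simp flip: ennreal_mult ennreal_plus add: mult_ac)
      also have "t m * real p powr (- (real m / ?d)) = real p powr (- ((1 / ?d - c) * real m))"
        unfolding t_def powr_add[symmetric] by (simp add: algebra_simps)
      also have "t m powr (1 - s) * real p ^ m = real p powr (- ((c * (s - 1) - 1) * real m))"
        using p0 by (simp add: t_def powr_powr powr_add[symmetric] algebra_simps flip: powr_realpow)
      also have "ennreal (A * real p powr (- ((1 / ?d - c) * real m)) + ?d * real p powr (- ((c * (s - 1) - 1) * real m)))
        \<le> ennreal (A * (2 powr (- \<delta>)) ^ m + ?d * (2 powr (- \<delta>)) ^ m)"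
        by (intro ennreal_leI add_mono mult_left_mono small A0) (auto simp: \<delta>_def)
      finally show ?thesis by (simp add: distrib_right)
    qed
    have "(\<integral>\<^sup>+y. ennreal (g (T y)) \<partial>?\<nu>) \<le> (\<integral>\<^sup>+y. (\<Sum>m. ennreal (g (T y)) * indicator (?E m) y) \<partial>?\<nu>)"
    proof (rule nn_integral_mono_AE, rule AE_mp[OF AE_crit_level[OF p d]], intro AE_I2 impI, elim exE)
      fix y m assume "y \<in> ?E m"
      then have "ennreal (g (T y)) = (\<Sum>m\<in>{m}. ennreal (g (T y)) * indicator (?E m) y)" by simp
      also have "\<dots> \<le> (\<Sum>m. ennreal (g (T y)) * indicator (?E m) y)"
        by (rule sum_le_suminf) auto
      finally show "ennreal (g (T y)) \<le> (\<Sum>m. ennreal (g (T y)) * indicator (?E m) y)" .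
    qed
    also have "\<dots> = (\<Sum>m. \<integral>\<^sup>+y. ennreal (g (T y)) * indicator (?E m) y \<partial>?\<nu>)"
      using g by (intro nn_integral_suminf) auto
    also have "\<dots> \<le> (\<Sum>m. ennreal ((A + ?d) * (2 powr (- \<delta>)) ^ m))"
      by (intro suminf_le level) auto
    also have "\<dots> = ennreal C"
      using sums A0 by (intro suminf_ennreal_eq) auto
    finally show "(\<integral>\<^sup>+y. ennreal (g (x \<ominus>\<^bsub>Zp p\<^esub> Zp_poly p P y)) \<partial>?\<nu>) \<le> ennreal C"
      unfolding T_def .
  qed
qed

section \<open>Lebesgue norms and the multilinear average\<close>

text \<open>
  Both sides are compared with a power of the largest factor. This crude form of Hoelder's
  inequality loses only a factor \<open>k\<close> once the functions are normalised.
\<close>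

lemma prod_le_sum_power:
  fixes a :: "'a \<Rightarrow> real"
  assumes S: "finite S" "S \<noteq> {}" and a: "\<And>i. i \<in> S \<Longrightarrow> 0 \<le> a i"
  shows "(\<Prod>i\<in>S. a i) \<le> (\<Sum>i\<in>S. a i ^ card S)"
proof -
  have "Max (a ` S) \<in> a ` S" using S by simp
  then obtain j where j: "j \<in> S" "a j = Max (a ` S)" by auto
  have "(\<Prod>i\<in>S. a i) \<le> (\<Prod>i\<in>S. a j)"
    using S a j by (intro prod_mono) auto
  also have "\<dots> = a j ^ card S" by simp
  also have "\<dots> \<le> (\<Sum>i\<in>S. a i ^ card S)"
    using S a j by (intro member_le_sum) auto
  finally show ?thesis .
qed

lemma Lq_norm_less_imp_nn_integral_le_1:
  assumes f: "f \<in> borel_measurable M" and r: "enn2real q > 0" and t: "Lq_norm M q f < ennreal t"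
  shows "(\<integral>\<^sup>+x. ennreal ((norm (f x) / t) powr enn2real q) \<partial>M) \<le> 1"
proof -
  let ?r = "enn2real q"
  define I where "I = (\<integral>\<^sup>+ x. ennreal (norm (f x) powr ?r) \<partial>M)"
  have q: "q \<noteq> \<infinity>" using r by auto
  have L: "Lq_norm M q f = (if I = \<infinity> then \<infinity> else ennreal (enn2real I powr (1 / ?r)))"
    unfolding Lq_norm_def I_def using q by simp
  have fin: "I \<noteq> \<infinity>" using t unfolding L by auto
  then have "ennreal (enn2real I powr (1 / ?r)) < ennreal t" using t unfolding L by simp
  then have It: "enn2real I powr (1 / ?r) < t" by (simp add: ennreal_less_iff)
  then have t0: "t > 0" by (rule le_less_trans[rotated]) simp
  have "(enn2real I powr (1 / ?r)) powr ?r \<le> t powr ?r"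
    using It r by (intro powr_mono2) auto
  then have It: "enn2real I \<le> t powr ?r" using r by (simp add: powr_powr)
  have "(\<integral>\<^sup>+x. ennreal ((norm (f x) / t) powr ?r) \<partial>M)
      = (\<integral>\<^sup>+x. ennreal (1 / t powr ?r) * ennreal (norm (f x) powr ?r) \<partial>M)"
    using t0 by (intro nn_integral_cong) (simp add: powr_divide flip: ennreal_mult)
  also have "\<dots> = ennreal (1 / t powr ?r) * I"
    unfolding I_def using f by (intro nn_integral_cmult) measurable
  also have "I = ennreal (enn2real I)" using fin by (simp add: top.not_eq_extremum)
  also have "ennreal (1 / t powr ?r) * ennreal (enn2real I) = ennreal (enn2real I / t powr ?r)"
    by (simp flip: ennreal_mult)
  also have "\<dots> \<le> ennreal 1"
    using It t0 by (intro ennreal_leI) simp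
  finally show ?thesis by simp
qed

lemma Lq_norm_le_of_bounded:
  assumes M: "prob_space M" and h: "h \<in> borel_measurable M" and q: "1 \<le> q"
    and B: "0 \<le> B" "\<And>x. x \<in> space M \<Longrightarrow> norm (h x) \<le> B"
  shows "Lq_norm M q h \<le> ennreal B"
proof (cases "q = \<infinity>")
  case True
  have "esssup M (\<lambda>x. ennreal (norm (h x))) \<le> ennreal B"
    using h B by (intro esssup_I) (auto intro!: AE_I2 ennreal_leI)
  then show ?thesis using True by (simp add: Lq_norm_def)
next
  case False
  interpret prob_space M by fact
  let ?r = "enn2real q"
  have r: "?r \<ge> 1"
    using enn2real_mono[OF q] False by (simp add: top.not_eq_extremum)
  define I where "I = (\<integral>\<^sup>+ x. ennreal (norm (h x) powr ?r) \<partial>M)"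
  have "I \<le> (\<integral>\<^sup>+ x. ennreal (B powr ?r) \<partial>M)"
    unfolding I_def using r B by (intro nn_integral_mono ennreal_leI powr_mono2) auto
  then have I: "I \<le> ennreal (B powr ?r)" by (simp add: emeasure_space_1)
  then have fin: "I \<noteq> \<infinity>" by (auto simp: top_unique)
  have "enn2real I \<le> B powr ?r"
    using enn2real_mono[OF I] by simp
  then have "enn2real I powr (1 / ?r) \<le> (B powr ?r) powr (1 / ?r)"
    using r by (intro powr_mono2) auto
  also have "\<dots> = B" using r B by (simp add: powr_powr)
  finally show ?thesis
    using False fin unfolding Lq_norm_def I_def[symmetric] by (simp add: Let_def ennreal_leI)
qed

lemma measurable_Zp_integrand:
  assumes p: "p > 0" and f: "\<And>i. i \<in> {1..k} \<Longrightarrow> f i \<in> borel_measurable (Zp_haar p)"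
    and X: "X \<in> measurable M (Zp_borel p)" and Y: "Y \<in> measurable M (Zp_borel p)"
  shows "(\<lambda>w. Zp_integrand p k P f (X w) (Y w)) \<in> borel_measurable M"
  unfolding Zp_integrand_def
proof (rule borel_measurable_prod)
  fix i assume i: "i \<in> {1..k}"
  have "f i \<in> borel_measurable (Zp_borel p)"
    using f[OF i] by (simp add: measurable_cong_sets[OF sets_Zp_haar[OF p] refl])
  from measurable_compose[OF measurable_Zp_shift[OF p X Y] this]
  show "(\<lambda>w. f i (X w \<ominus>\<^bsub>Zp p\<^esub> Zp_poly p (P i) (Y w))) \<in> borel_measurable M" .
qed

text \<open>
  The strict bounds \<open>t i\<close> stand for the norms: they are positive, so one can divide by them
  even when some \<open>f i\<close> vanishes almost everywhere.
\<close>

lemma nn_integral_Zp_integrand_le: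
  fixes P :: "nat \<Rightarrow> int poly" and qs :: "nat \<Rightarrow> ennreal"
  assumes k: "k \<ge> 1" and d: "\<And>i. i \<in> {1..k} \<Longrightarrow> degree (P i) \<ge> 1"
    and qs: "\<And>i. i \<in> {1..k} \<Longrightarrow> real k * (real (degree (P i)) + 1) < enn2real (qs i)"
  shows "\<exists>C\<ge>0. \<forall>p f t x. prime p \<longrightarrow> x \<in> carrier (Zp p) \<longrightarrow>
    (\<forall>i\<in>{1..k}. f i \<in> borel_measurable (Zp_haar p) \<and> Lq_norm (Zp_haar p) (qs i) (f i) < ennreal (t i)) \<longrightarrow>
    (\<integral>\<^sup>+y. ennreal (norm (Zp_integrand p k P f x y)) \<partial>Zp_haar p) \<le> ennreal (C * (\<Prod>i\<in>{1..k}. t i))"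
proof -
  let ?s = "\<lambda>i. enn2real (qs i) / real k"
  have "\<exists>C. \<forall>i\<in>{1..k}. C i \<ge> 0 \<and>
    (\<forall>p x g. prime p \<longrightarrow> x \<in> carrier (Zp p) \<longrightarrow> g \<in> borel_measurable (Zp_haar p) \<longrightarrow>
      (\<forall>z. 0 \<le> g z) \<longrightarrow> (\<integral>\<^sup>+z. ennreal (g z powr ?s i) \<partial>Zp_haar p) \<le> 1 \<longrightarrow>
      (\<integral>\<^sup>+y. ennreal (g (x \<ominus>\<^bsub>Zp p\<^esub> Zp_poly p (P i) y)) \<partial>Zp_haar p) \<le> ennreal (C i))"
  proof (rule bchoice, rule ballI)
    fix i assume i: "i \<in> {1..k}"
    have "real (degree (P i)) + 1 < ?s i"
      using qs[OF i] k by (simp add: field_simps)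
    from pushforward_bound[OF d[OF i] this]
    show "\<exists>C. C \<ge> 0 \<and>
      (\<forall>p x g. prime p \<longrightarrow> x \<in> carrier (Zp p) \<longrightarrow> g \<in> borel_measurable (Zp_haar p) \<longrightarrow>
        (\<forall>z. 0 \<le> g z) \<longrightarrow> (\<integral>\<^sup>+z. ennreal (g z powr ?s i) \<partial>Zp_haar p) \<le> 1 \<longrightarrow>
        (\<integral>\<^sup>+y. ennreal (g (x \<ominus>\<^bsub>Zp p\<^esub> Zp_poly p (P i) y)) \<partial>Zp_haar p) \<le> ennreal C)" .
  qed
  then obtain C where C0: "\<And>i. i \<in> {1..k} \<Longrightarrow> C i \<ge> 0"
    and C: "\<And>i p x g. i \<in> {1..k} \<Longrightarrow> prime p \<Longrightarrow> x \<in> carrier (Zp p) \<Longrightarrow>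
      g \<in> borel_measurable (Zp_haar p) \<Longrightarrow> (\<And>z. 0 \<le> g z) \<Longrightarrow>
      (\<integral>\<^sup>+z. ennreal (g z powr ?s i) \<partial>Zp_haar p) \<le> 1 \<Longrightarrow>
      (\<integral>\<^sup>+y. ennreal (g (x \<ominus>\<^bsub>Zp p\<^esub> Zp_poly p (P i) y)) \<partial>Zp_haar p) \<le> ennreal (C i)"
    by blast
  show ?thesis
  proof (intro exI[of _ "\<Sum>i\<in>{1..k}. C i"] conjI allI impI)
    show "0 \<le> (\<Sum>i\<in>{1..k}. C i)" by (intro sum_nonneg C0)
    fix p f x and t :: "nat \<Rightarrow> real"
    assume p: "prime p" and x: "x \<in> carrier (Zp p)"
      and ft: "\<forall>i\<in>{1..k}. f i \<in> borel_measurable (Zp_haar p) \<and> Lq_norm (Zp_haar p) (qs i) (f i) < ennreal (t i)"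
    have p0: "p > 0" using prime_gt_0_nat[OF p] .
    let ?\<nu> = "Zp_haar p"
    let ?T = "\<lambda>i y. x \<ominus>\<^bsub>Zp p\<^esub> Zp_poly p (P i) y"
    have f: "f i \<in> borel_measurable ?\<nu>" and t: "Lq_norm ?\<nu> (qs i) (f i) < ennreal (t i)"
      if "i \<in> {1..k}" for i using ft that by auto
    have t0: "t i > 0" if "i \<in> {1..k}" for i
      using le_less_trans[OF zero_le t[OF that]] by simp
    have pt: "0 \<le> (\<Prod>i\<in>{1..k}. t i)"
      by (intro prod_nonneg less_imp_le t0)
    have meas: "(\<lambda>y. ennreal ((norm (f i (?T i y)) / t i) ^ k)) \<in> borel_measurable ?\<nu>" if i: "i \<in> {1..k}" for i
    proof -
      have "?T i \<in> measurable ?\<nu> ?\<nu>"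
        unfolding measurable_cong_sets[OF refl sets_Zp_haar[OF p0]]
        by (rule measurable_Zp_shift[OF p0]) (use x measurable_ident_sets[OF sets_Zp_haar[OF p0]] in auto)
      from measurable_compose[OF this f[OF i]] show ?thesis by measurable
    qed
    have one: "(\<integral>\<^sup>+y. ennreal ((norm (f i (?T i y)) / t i) ^ k) \<partial>?\<nu>) \<le> ennreal (C i)" if i: "i \<in> {1..k}" for i
    proof (rule C[OF i p x, of "\<lambda>z. (norm (f i z) / t i) ^ k"])
      show "(\<lambda>z. (norm (f i z) / t i) ^ k) \<in> borel_measurable ?\<nu>" using f[OF i] by measurable
      show "0 \<le> (norm (f i z) / t i) ^ k" for z using t0[OF i] by simp
      have r: "enn2real (qs i) > 0"
        using qs[OF i] by (rule le_less_trans[rotated]) simp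
      have "((norm (f i z) / t i) ^ k) powr ?s i = (norm (f i z) / t i) powr enn2real (qs i)" for z
      proof (cases "norm (f i z) = 0")
        case True
        then show ?thesis using k r by simp
      next
        case False
        then have "norm (f i z) / t i > 0" using t0[OF i] by simp
        then show ?thesis using k by (simp add: powr_powr flip: powr_realpow)
      qed
      then show "(\<integral>\<^sup>+z. ennreal (((norm (f i z) / t i) ^ k) powr ?s i) \<partial>?\<nu>) \<le> 1"
        using Lq_norm_less_imp_nn_integral_le_1[OF f[OF i] r t[OF i]] by simp
    qed
    have "(\<integral>\<^sup>+y. ennreal (norm (Zp_integrand p k P f x y)) \<partial>?\<nu>)
      \<le> (\<integral>\<^sup>+y. ennreal (\<Prod>i\<in>{1..k}. t i) * (\<Sum>i\<in>{1..k}. ennreal ((norm (f i (?T i y)) / t i) ^ k)) \<partial>?\<nu>)"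
    proof (rule nn_integral_mono)
      fix y
      let ?a = "\<lambda>i. norm (f i (?T i y)) / t i"
      have a0: "?a i \<ge> 0" if "i \<in> {1..k}" for i using t0[OF that] by simp
      have "norm (Zp_integrand p k P f x y) = (\<Prod>i\<in>{1..k}. t i * ?a i)"
        unfolding Zp_integrand_def prod_norm[symmetric]
        by (intro prod.cong refl) (use t0 in force)
      also have "\<dots> = (\<Prod>i\<in>{1..k}. t i) * (\<Prod>i\<in>{1..k}. ?a i)" by (rule prod.distrib)
      also have "\<dots> \<le> (\<Prod>i\<in>{1..k}. t i) * (\<Sum>i\<in>{1..k}. ?a i ^ k)"
        using prod_le_sum_power[of "{1..k}" ?a] a0 k t0
        by (intro mult_left_mono prod_nonneg) (auto intro: less_imp_le)
      finally have "ennreal (norm (Zp_integrand p k P f x y))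
          \<le> ennreal ((\<Prod>i\<in>{1..k}. t i) * (\<Sum>i\<in>{1..k}. ?a i ^ k))" by (rule ennreal_leI)
      also have "\<dots> = ennreal (\<Prod>i\<in>{1..k}. t i) * (\<Sum>i\<in>{1..k}. ennreal (?a i ^ k))"
        using a0 by (simp only: ennreal_mult'[OF pt] sum_ennreal zero_le_power)
      finally show "ennreal (norm (Zp_integrand p k P f x y))
          \<le> ennreal (\<Prod>i\<in>{1..k}. t i) * (\<Sum>i\<in>{1..k}. ennreal (?a i ^ k))" .
    qed
    also have "\<dots> = ennreal (\<Prod>i\<in>{1..k}. t i) *
        (\<Sum>i\<in>{1..k}. \<integral>\<^sup>+y. ennreal ((norm (f i (?T i y)) / t i) ^ k) \<partial>?\<nu>)"
      by (simp only: nn_integral_cmult[OF borel_measurable_sum[OF meas]] nn_integral_sum[OF meas])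
    also have "\<dots> \<le> ennreal (\<Prod>i\<in>{1..k}. t i) * (\<Sum>i\<in>{1..k}. ennreal (C i))"
      by (intro mult_left_mono sum_mono one) auto
    also have "\<dots> = ennreal ((\<Sum>i\<in>{1..k}. C i) * (\<Prod>i\<in>{1..k}. t i))"
      using C0 by (simp only: mult.commute[of "\<Sum>i\<in>{1..k}. C i"] ennreal_mult'[OF pt] sum_ennreal)
    finally show "(\<integral>\<^sup>+y. ennreal (norm (Zp_integrand p k P f x y)) \<partial>?\<nu>)
      \<le> ennreal ((\<Sum>i\<in>{1..k}. C i) * (\<Prod>i\<in>{1..k}. t i))" .
  qed
qed

text \<open>
  Letting each \<open>t i\<close> in the previous bound decrease to the norm of \<open>f i\<close> gives the pointwise estimate
  for every \<open>x\<close>, hence the estimate in \<open>L\<^sup>q\<close>.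
\<close>

lemma Zp_avg_bounded_by_uniform:
  fixes P :: "nat \<Rightarrow> int poly" and qs :: "nat \<Rightarrow> ennreal"
  assumes k: "k \<ge> 1" and d: "\<And>i. i \<in> {1..k} \<Longrightarrow> degree (P i) \<ge> 1"
    and qs: "\<And>i. i \<in> {1..k} \<Longrightarrow> real k * (real (degree (P i)) + 1) < enn2real (qs i)"
    and q: "1 \<le> q"
  shows "\<exists>C::real. \<forall>p. prime p \<longrightarrow> Zp_avg_bounded_by p k P qs q (ennreal C)"
proof -
  obtain C where C0: "C \<ge> 0" and C: "\<And>p f t x. prime p \<Longrightarrow> x \<in> carrier (Zp p) \<Longrightarrow>
    (\<forall>i\<in>{1..k}. f i \<in> borel_measurable (Zp_haar p) \<and> Lq_norm (Zp_haar p) (qs i) (f i) < ennreal (t i)) \<Longrightarrow>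
    (\<integral>\<^sup>+y. ennreal (norm (Zp_integrand p k P f x y)) \<partial>Zp_haar p) \<le> ennreal (C * (\<Prod>i\<in>{1..k}. t i))"
    using nn_integral_Zp_integrand_le[where P = P, OF k d qs] by blast
  show ?thesis
  proof (intro exI[of _ C] allI impI, unfold Zp_avg_bounded_by_def, intro allI impI)
    fix p f assume p: "prime p" and f: "\<forall>i\<in>{1..k}. f i \<in> Lq_space (Zp_haar p) (qs i)"
    have p0: "p > 0" using prime_gt_0_nat[OF p] .
    let ?\<nu> = "Zp_haar p"
    interpret prob_space ?\<nu> by (rule prob_space_Zp_haar[OF p0])
    note s = sets_Zp_haar[OF p0]
    define N where "N = (\<lambda>i. enn2real (Lq_norm ?\<nu> (qs i) (f i)))"
    have N: "Lq_norm ?\<nu> (qs i) (f i) = ennreal (N i)" and fm: "f i \<in> borel_measurable ?\<nu>"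
      if "i \<in> {1..k}" for i
      using f that by (auto simp: N_def Lq_space_def)
    have N0: "N i \<ge> 0" for i by (simp add: N_def)
    have bound: "(\<integral>\<^sup>+y. ennreal (norm (Zp_integrand p k P f x y)) \<partial>?\<nu>)
        \<le> ennreal (C * (\<Prod>i\<in>{1..k}. N i + \<epsilon>))" if x: "x \<in> carrier (Zp p)" and e: "\<epsilon> > 0" for x \<epsilon>
    proof (rule C[OF p x], intro ballI conjI)
      fix i assume i: "i \<in> {1..k}"
      show "f i \<in> borel_measurable ?\<nu>" by (rule fm[OF i])
      show "Lq_norm ?\<nu> (qs i) (f i) < ennreal (N i + \<epsilon>)"
        unfolding N[OF i] using e N0 by (simp add: ennreal_less_iff)
    qed
    have int: "integrable ?\<nu> (Zp_integrand p k P f x)" if x: "x \<in> carrier (Zp p)" for x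
    proof (rule integrableI_bounded)
      have "(\<lambda>y. Zp_integrand p k P f ((\<lambda>_. x) y) ((\<lambda>y. y) y)) \<in> borel_measurable ?\<nu>"
        by (rule measurable_Zp_integrand[OF p0 fm])
          (use x measurable_ident_sets[OF s] in auto)
      then show "Zp_integrand p k P f x \<in> borel_measurable ?\<nu>" by simp
      show "(\<integral>\<^sup>+y. ennreal (norm (Zp_integrand p k P f x y)) \<partial>?\<nu>) < \<infinity>"
        using bound[OF x zero_less_one] by (rule le_less_trans) simp
    qed
    have le: "norm (Zp_avg p k P f x) \<le> C * (\<Prod>i\<in>{1..k}. N i)" if x: "x \<in> carrier (Zp p)" for x
    proof -
      have le_eps: "norm (Zp_avg p k P f x) \<le> C * (\<Prod>i\<in>{1..k}. N i + \<epsilon>)" if e: "\<epsilon> > 0" for \<epsilon>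
      proof -
        have "ennreal (norm (Zp_avg p k P f x)) \<le> (\<integral>\<^sup>+y. ennreal (norm (Zp_integrand p k P f x y)) \<partial>?\<nu>)"
          unfolding Zp_avg_def by (rule integral_norm_bound_ennreal[OF int[OF x]])
        also note bound[OF x e]
        finally show ?thesis
          using C0 N0 e by (subst (asm) ennreal_le_iff) (auto intro!: mult_nonneg_nonneg prod_nonneg add_nonneg_nonneg)
      qed
      have "((\<lambda>\<epsilon>. C * (\<Prod>i\<in>{1..k}. N i + \<epsilon>)) \<longlongrightarrow> C * (\<Prod>i\<in>{1..k}. N i + 0)) (at_right 0)"
        by (intro tendsto_intros)
      then show ?thesis
        using le_eps by (intro tendsto_lowerbound[of _ _ "at_right 0"])
          (auto simp: eventually_at_right_less intro!: eventually_at_rightI[of 0 1])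
    qed
    have avg_meas: "Zp_avg p k P f \<in> borel_measurable ?\<nu>"
    proof -
      have id: "(\<lambda>y. y) \<in> measurable ?\<nu> (Zp_borel p)" by (rule measurable_ident_sets[OF s])
      have "(\<lambda>w. Zp_integrand p k P f (fst w) (snd w)) \<in> borel_measurable (?\<nu> \<Otimes>\<^sub>M ?\<nu>)"
        by (rule measurable_Zp_integrand[OF p0 fm])
          (use measurable_compose[OF measurable_fst id] measurable_compose[OF measurable_snd id] in auto)
      then have "(\<lambda>x. \<integral>y. Zp_integrand p k P f x y \<partial>?\<nu>) \<in> borel_measurable ?\<nu>"
        by (intro borel_measurable_lebesgue_integral) (simp add: split_beta')
      then show ?thesis unfolding Zp_avg_def[abs_def] .
    qed
    show "(AE x in ?\<nu>. integrable ?\<nu> (Zp_integrand p k P f x)) \<and>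
      Zp_avg p k P f \<in> borel_measurable ?\<nu> \<and>
      Lq_norm ?\<nu> q (Zp_avg p k P f) \<le> ennreal C * (\<Prod>i\<in>{1..k}. Lq_norm ?\<nu> (qs i) (f i))"
    proof (intro conjI avg_meas)
      show "AE x in ?\<nu>. integrable ?\<nu> (Zp_integrand p k P f x)"
        using int by (intro AE_I2) (simp add: space_Zp_haar p0)
      have "Lq_norm ?\<nu> q (Zp_avg p k P f) \<le> ennreal (C * (\<Prod>i\<in>{1..k}. N i))"
        using le C0 N0 by (intro Lq_norm_le_of_bounded[OF prob_space_axioms avg_meas q])
          (auto simp: space_Zp_haar p0 intro!: mult_nonneg_nonneg prod_nonneg)
      also have "\<dots> = ennreal C * (\<Prod>i\<in>{1..k}. ennreal (N i))"
        using C0 N0 by (simp add: ennreal_mult prod_ennreal prod_nonneg)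
      also have "(\<Prod>i\<in>{1..k}. ennreal (N i)) = (\<Prod>i\<in>{1..k}. Lq_norm ?\<nu> (qs i) (f i))"
        using N by (intro prod.cong) auto
      finally show "Lq_norm ?\<nu> q (Zp_avg p k P f) \<le> ennreal C * (\<Prod>i\<in>{1..k}. Lq_norm ?\<nu> (qs i) (f i))" .
    qed
  qed
qed

theorem theorem6p2:
  fixes k :: nat and P :: "nat \<Rightarrow> int poly" and q :: ennreal and qs :: "nat \<Rightarrow> ennreal"
  assumes "k \<ge> 2"
    and "1 \<le> degree (P 1)"
    and "strict_mono_on {1..k} (\<lambda>i. degree (P i))"
    and "1 \<le> q"
    and "\<And>i. i \<in> {1..k} \<Longrightarrow> of_nat (10 * k * degree (P k)) \<le> qs i \<and> qs i < \<infinity>"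
  shows "\<exists>C::real. \<forall>p. prime p \<longrightarrow> Zp_avg_norm p k P qs q \<le> ennreal C"
proof -
  have mono: "degree (P i) \<le> degree (P j)" if "i \<in> {1..k}" "j \<in> {1..k}" "i \<le> j" for i j
    by (rule mono_onD[OF strict_mono_on_imp_mono_on[OF assms(3)] that])
  have d: "1 \<le> degree (P i)" if "i \<in> {1..k}" for i
    using mono[of 1 i] that assms(1,2) by auto
  have "real k * (real (degree (P i)) + 1) < enn2real (qs i)" if i: "i \<in> {1..k}" for i
  proof -
    have "ennreal (real (10 * k * degree (P k))) \<le> qs i"
      using assms(5)[OF i] by (simp only: ennreal_of_nat_eq_real_of_nat)
    then have "real (10 * k * degree (P k)) \<le> enn2real (qs i)"
      using assms(5)[OF i] enn2real_mono[of "ennreal (real (10 * k * degree (P k)))" "qs i"]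
      by (simp only: enn2real_ennreal of_nat_0_le_iff) (simp add: top.not_eq_extremum)
    moreover have "real k * (real (degree (P i)) + 1) < real k * (10 * real (degree (P k)))"
      using d[OF i] mono[of i k] i assms(1) by (intro mult_strict_left_mono) auto
    ultimately show ?thesis by (simp add: mult_ac)
  qed
  then obtain C :: real where "\<forall>p. prime p \<longrightarrow> Zp_avg_bounded_by p k P qs q (ennreal C)"
    using Zp_avg_bounded_by_uniform[of k P qs q] d assms(1,4) by auto
  then show ?thesis
    unfolding Zp_avg_norm_def by (intro exI[of _ C]) (auto intro: Inf_lower)
qed

end
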